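(* For every $w\in W$, the function $\phi_w(\Lambda_0)$ is a polynomial in the variables $\alpha=(\alpha_i)_{i\in\mathbf{Z}}$ and $f=(f_i)_{i\in\mathbf{Z}}$ with integral coefficients, i.e. $\phi_w(\Lambda_0)\in\mathbf{Z}[\alpha;f]$. Its leading term with respect to $f$ is $\prod_{i\in\mathbf{Z}}f_i^{\nu_i}$, where $\nu_i$ is the number of nodes of color $i$ in the Young diagram $Y$ corresponding to $w(\Lambda_0)$.
   Context: Field and group action. Let $K=\mathbf{C}(\alpha;f;\tau)$ be the field of rational functions in infinitely many independent variables $\alpha_i,f_i,\tau_i$ $(i\in\mathbf{Z})$. For each $i\in\mathbf{Z}$ let $s_i$ be the field automorphism of $K$ (over $\mathbf{C}$) with $s_i(\alpha_i)=-\alpha_i$, $s_i(\alpha_{i\pm1})=\alpha_{i\pm1}+\alpha_i$, $s_i(\alpha_j)=\alpha_j$ $(j\ne i,i\pm1)$; $s_i(f_i)=f_i$, $s_i(f_{i\pm1})=f_{i\pm1}\pm\alpha_i/f_i$, $s_i(f_j)=f_j$ $(j\neq i,i\pm1)$; $s_i(\tau_i)=f_i\tau_{i-1}\tau_{i+1}/\tau_i$, $s_i(\tau_j)=\tau_j$ $(j\ne i)$. These satisfy $s_i^2=1$, $(s_is_{i+1})^3=1$, $s_is_j=s_js_i$ $(j\ne i\pm1)$ and so define an action on $K$ of the Weyl group $W=W(A_\infty)$ (the Coxeter group with generators $s_i$, $i\in\mathbf Z$, and these relations). Weights. $W$ also acts on the free $\mathbf Z$-module with basis $\Lambda_i$ $(i\in\mathbf{Z})$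 by $s_i(\Lambda_i)=\Lambda_{i+1}+\Lambda_{i-1}-\Lambda_i$, $s_i(\Lambda_j)=\Lambda_j$ $(j\ne i)$. Put $v_i=\Lambda_i-\Lambda_{i-1}$; then $s_i$ swaps $v_i$ and $v_{i+1}$ and fixes the other $v_j$, so $W$ is identified with the group of finitely supported permutations of $\mathbf{Z}$, via $w(v_j)=v_{\sigma_w(j)}$. Formally $\Lambda_0=\sum_{j\le0}v_j$ and $w(\Lambda_0)=\sum_{i\in M}v_i$ with $M=\sigma_w(\mathbf{Z}_{\le0})$ (the Maya diagram); $M$ depends only on $w(\Lambda_0)$. Partitions. A partition $\lambda=(\lambda_1\ge\dots\ge\lambda_l>0)$ is identified with its Young diagram $Y=\{(i,j):1\le i\le l,\ 1\le j\le\lambda_i\}$; $\lambda'$ is the transposed partition. Its Frobenius symbol is $(I,J)=(\{i_1>\dots>i_k>0\},\{j_1>\dots>j_k\ge0\})$, $i_n=\lambda_n-n+1$, $j_n=\lambda'_n-n$, $k=\max\{n:\lambda_n\ge n\}$ ($I=J=\emptyset$ for the empty partition). The partition (Young diagram) corresponding to $w(\Lambda_0)$ is the one whose Frobenius symbol satisfies $I=M\cap\mathbf{Z}_{>0}$ and $-J=\mathbf{Z}_{\le0}\setminus M$. The color of the node $(i,j)\in Y$ is $j-i$. Functions. For $w\in W$, $\phi_w(\Lambda_0)\in\mathbf{C}(\alpha;f)$ is defined by $w(\tau_0)=\phi_w(\Lambda_0)\prod_{i\in\mathbf{Z}}\tau_i^{m_i}$, where $m_i\in\{0,\pm1\}$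 is the coefficient of $\Lambda_i$ in $w(\Lambda_0)$. The leading term with respect to $f$ means the homogeneous component of highest total degree in the variables $f_i$ (with the $\alpha_i$ treated as coefficients). *)

theory Defs
  imports Complex_Main "HOL-Library.Poly_Mapping" "HOL-Computational_Algebra.Fraction_Field"
begin

section \<open>The field \<open>K\<close> of rational functions\<close>

datatype gen = Alpha int | Fvar int | Tau int

text \<open>
  The linear order on the variables plays no mathematical role; it is what the library asks for
  to make the polynomial ring an integral domain.
\<close>

instantiation gen :: linorder
begin

fun gen_code :: "gen \<Rightarrow> nat \<times> int" where
  "gen_code (Alpha i) = (0, i)"
| "gen_code (Fvar i) = (1, i)"
| "gen_code (Tau i) = (2, i)"

definition less_eq_gen :: "gen \<Rightarrow> gen \<Rightarrow> bool" where
  "x \<le> y \<longleftrightarrow> fst (gen_code x) < fst (gen_code y)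
      \<or> fst (gen_code x) = fst (gen_code y) \<and> snd (gen_code x) \<le> snd (gen_code y)"

definition less_gen :: "gen \<Rightarrow> gen \<Rightarrow> bool" where
  "x < y \<longleftrightarrow> x \<le> y \<and> \<not> y \<le> (x::gen)"

instance
proof
  fix x y z :: gen
  show "x < y \<longleftrightarrow> x \<le> y \<and> \<not> y \<le> x" by (rule less_gen_def)
  show "x \<le> x" by (simp add: less_eq_gen_def)
  show "x \<le> z" if "x \<le> y" "y \<le> z" using that by (auto simp: less_eq_gen_def)
  show "x = y" if "x \<le> y" "y \<le> x"
    using that by (cases x; cases y) (auto simp: less_eq_gen_def)
  show "x \<le> y \<or> y \<le> x" by (auto simp: less_eq_gen_def)
qed

end

abbreviation (input) lookup :: "('a \<Rightarrow>\<^sub>0 'b::zero) \<Rightarrow> 'a \<Rightarrow> 'b" where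
  "lookup \<equiv> Poly_Mapping.lookup"

abbreviation (input) keys :: "('a \<Rightarrow>\<^sub>0 'b::zero) \<Rightarrow> 'a set" where
  "keys \<equiv> Poly_Mapping.keys"

type_synonym mon = "gen \<Rightarrow>\<^sub>0 nat"
type_synonym pol = "mon \<Rightarrow>\<^sub>0 complex"
type_synonym K = "pol fract"

definition indet :: "gen \<Rightarrow> pol" where
  "indet v = Poly_Mapping.single (Poly_Mapping.single v 1) 1"

definition const_pol :: "complex \<Rightarrow> pol" where
  "const_pol c = Poly_Mapping.single 0 c"

definition of_pol :: "pol \<Rightarrow> K" where
  "of_pol p = Fract p 1"

definition \<alpha>_K :: "int \<Rightarrow> K" where "\<alpha>_K i = of_pol (indet (Alpha i))"
definition f_K :: "int \<Rightarrow> K" where "f_K i = of_pol (indet (Fvar i))"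
definition \<tau>_K :: "int \<Rightarrow> K" where "\<tau>_K i = of_pol (indet (Tau i))"

definition field_automorphism :: "(K \<Rightarrow> K) \<Rightarrow> bool" where
  "field_automorphism g \<longleftrightarrow> bij g \<and> (\<forall>x y. g (x + y) = g x + g y) \<and> (\<forall>x y. g (x * y) = g x * g y)
     \<and> (\<forall>c. g (of_pol (const_pol c)) = of_pol (const_pol c))"

fun s_gen :: "int \<Rightarrow> gen \<Rightarrow> K" where
  "s_gen i (Alpha j) =
     (if j = i then - \<alpha>_K i else if j = i + 1 \<or> j = i - 1 then \<alpha>_K j + \<alpha>_K i else \<alpha>_K j)"
| "s_gen i (Fvar j) =
     (if j = i + 1 then f_K j + \<alpha>_K i / f_K i else if j = i - 1 then f_K j - \<alpha>_K i / f_K i else f_K j)"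
| "s_gen i (Tau j) =
     (if j = i then f_K i * \<tau>_K (i - 1) * \<tau>_K (i + 1) / \<tau>_K i else \<tau>_K j)"

definition s_K :: "int \<Rightarrow> K \<Rightarrow> K" where
  "s_K i = (THE g. field_automorphism g \<and> (\<forall>v. g (of_pol (indet v)) = s_gen i v))"

subsection \<open>Existence and uniqueness of the automorphisms\<close>

lemma of_pol_simps [simp]:
  "of_pol (p + q) = of_pol p + of_pol q"
  "of_pol (p * q) = of_pol p * of_pol q"
  "of_pol (- p) = - of_pol p"
  "of_pol (p - q) = of_pol p - of_pol q"
  "of_pol 0 = 0" "of_pol 1 = 1"
  "of_pol p = of_pol q \<longleftrightarrow> p = q"
  by (simp_all add: of_pol_def eq_fract fract_collapse)

lemma of_pol_eq_0 [simp]: "of_pol p = 0 \<longleftrightarrow> p = 0"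
  using of_pol_simps(5,7) by metis

lemma of_pol_power [simp]: "of_pol (p ^ n) = of_pol p ^ n"
  by (induction n) auto

lemma Fract_of_pol: "b \<noteq> 0 \<Longrightarrow> Fract a b = of_pol a / of_pol b"
  by (simp add: of_pol_def)

lemma indet_neq_0 [simp]: "indet v \<noteq> 0"
  unfolding indet_def by (metis lookup_single_eq lookup_zero one_neq_zero)

lemma gens_neq_0 [simp]: "\<alpha>_K i \<noteq> 0" "f_K i \<noteq> 0" "\<tau>_K i \<noteq> 0"
  by (simp_all add: \<alpha>_K_def f_K_def \<tau>_K_def)

lemma C_simps: "const_pol (a + b) = const_pol a + const_pol b" "const_pol (a * b) = const_pol a * const_pol b" "const_pol 0 = 0" "const_pol 1 = 1" "const_pol (- a) = - const_pol a"
  by (simp_all add: const_pol_def single_add mult_single single_uminus)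

lemma pol_sum_single:
  fixes p :: "'a \<Rightarrow>\<^sub>0 'b::comm_monoid_add"
  shows "p = (\<Sum>m\<in>keys p. Poly_Mapping.single m (lookup p m))"
  by (rule poly_mapping_eqI) (auto simp: lookup_sum lookup_single when_def in_keys_iff)

lemma single_mon: "Poly_Mapping.single m c = const_pol c * (\<Prod>v\<in>keys m. indet v ^ lookup m v)"
proof -
  have X_power: "indet v ^ n = Poly_Mapping.single (Poly_Mapping.single v n) 1" for v n
    by (induction n) (auto simp: indet_def mult_single single_add [symmetric])
  have "(\<Prod>v\<in>A. indet v ^ lookup m v) = Poly_Mapping.single (\<Sum>v\<in>A. Poly_Mapping.single v (lookup m v)) 1"
    if "finite A" for A
    using that by (induction A rule: finite_induct) (auto simp: X_power mult_single)
  from this [of "keys m"] show ?thesis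
    by (simp add: pol_sum_single [symmetric] const_pol_def mult_single)
qed

lemma pol_induct [case_names const_pol indet add mult]:
  fixes p :: pol
  assumes const_pol: "\<And>c. P (const_pol c)" and indet: "\<And>v. P (indet v)"
    and add: "\<And>p q. P p \<Longrightarrow> P q \<Longrightarrow> P (p + q)" and mult: "\<And>p q. P p \<Longrightarrow> P q \<Longrightarrow> P (p * q)"
  shows "P p"
proof -
  have P1: "P 1" and P0: "P 0" using const_pol [of 1] const_pol [of 0] by (simp_all add: C_simps)
  have P_power: "P (indet v ^ n)" for v n
    by (induction n) (auto intro: P1 indet mult)
  have P_prod: "P (\<Prod>v\<in>A. indet v ^ lookup m v)" for A m
    by (induction A rule: infinite_finite_induct) (auto intro: P1 P_power mult)
  have "P (Poly_Mapping.single m c)" for m c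
    by (subst single_mon) (intro mult const_pol P_prod)
  then have "P (\<Sum>m\<in>A. Poly_Mapping.single m (lookup p m))" for A
    by (induction A rule: infinite_finite_induct) (auto intro: P0 add)
  then show ?thesis by (subst pol_sum_single)
qed

definition mon_subst :: "(gen \<Rightarrow> K) \<Rightarrow> mon \<Rightarrow> K" where
  "mon_subst \<sigma> m = (\<Prod>v\<in>keys m. \<sigma> v ^ lookup m v)"

definition pol_subst :: "(gen \<Rightarrow> K) \<Rightarrow> pol \<Rightarrow> K" where
  "pol_subst \<sigma> p = (\<Sum>m\<in>keys p. of_pol (const_pol (lookup p m)) * mon_subst \<sigma> m)"

lemma mon_subst_superset:
  "finite A \<Longrightarrow> keys m \<subseteq> A \<Longrightarrow> mon_subst \<sigma> m = (\<Prod>v\<in>A. \<sigma> v ^ lookup m v)"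
  unfolding mon_subst_def by (rule prod.mono_neutral_left) (auto simp: in_keys_iff)

lemma mon_subst_add: "mon_subst \<sigma> (m + n) = mon_subst \<sigma> m * mon_subst \<sigma> n"
proof -
  let ?A = "keys m \<union> keys n"
  have "mon_subst \<sigma> (m + n) = (\<Prod>v\<in>?A. \<sigma> v ^ lookup (m + n) v)"
    by (rule mon_subst_superset) (auto simp: Poly_Mapping.keys_add)
  also have "\<dots> = (\<Prod>v\<in>?A. \<sigma> v ^ lookup m v) * (\<Prod>v\<in>?A. \<sigma> v ^ lookup n v)"
    by (simp add: lookup_add power_add prod.distrib)
  finally show ?thesis by (simp add: mon_subst_superset [of ?A])
qed

lemma subst_add: "pol_subst \<sigma> (p + q) = pol_subst \<sigma> p + pol_subst \<sigma> q"
  unfolding pol_subst_def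
  by (rule setsum_keys_plus_distrib) (auto simp: C_simps algebra_simps)

lemma subst_single: "pol_subst \<sigma> (Poly_Mapping.single m c) = of_pol (const_pol c) * mon_subst \<sigma> m"
  by (simp add: pol_subst_def C_simps)

lemma subst_0: "pol_subst \<sigma> 0 = 0"
  by (simp add: pol_subst_def)

lemma subst_sum: "pol_subst \<sigma> (sum g A) = (\<Sum>a\<in>A. pol_subst \<sigma> (g a))"
  by (induction A rule: infinite_finite_induct) (auto simp: subst_0 subst_add)

lemma subst_mult: "pol_subst \<sigma> (p * q) = pol_subst \<sigma> p * pol_subst \<sigma> q"
proof -
  have "p * q = (\<Sum>m\<in>keys p. \<Sum>n\<in>keys q.
      Poly_Mapping.single m (lookup p m) * Poly_Mapping.single n (lookup q n))"
    by (subst pol_sum_single [of p], subst pol_sum_single [of q]) (rule sum_product)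
  then have "pol_subst \<sigma> (p * q) = (\<Sum>m\<in>keys p. \<Sum>n\<in>keys q.
      (of_pol (const_pol (lookup p m)) * mon_subst \<sigma> m) * (of_pol (const_pol (lookup q n)) * mon_subst \<sigma> n))"
    by (simp add: subst_sum mult_single subst_single mon_subst_add C_simps mult_ac)
  then show ?thesis by (simp add: sum_product pol_subst_def)
qed

lemma subst_C: "pol_subst \<sigma> (const_pol c) = of_pol (const_pol c)"
  using subst_single [of \<sigma> 0 c] by (simp add: mon_subst_def flip: const_pol_def)

lemma subst_X: "pol_subst \<sigma> (indet v) = \<sigma> v"
  by (simp add: indet_def subst_single mon_subst_def C_simps)

lemma subst_1: "pol_subst \<sigma> 1 = 1"
  using subst_C [of \<sigma> 1] by (simp add: C_simps)

lemma subst_uminus: "pol_subst \<sigma> (- p) = - pol_subst \<sigma> p"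
  using subst_add [of \<sigma> p "- p"] by (simp add: subst_0 eq_neg_iff_add_eq_0 add.commute)

lemma subst_diff: "pol_subst \<sigma> (p - q) = pol_subst \<sigma> p - pol_subst \<sigma> q"
  using subst_add [of \<sigma> p "- q"] by (simp add: subst_uminus)

lemma subst_power: "pol_subst \<sigma> (p ^ n) = pol_subst \<sigma> p ^ n"
  by (induction n) (auto simp: subst_1 subst_mult)

definition field_hom :: "(K \<Rightarrow> K) \<Rightarrow> bool" where
  "field_hom g \<longleftrightarrow> (\<forall>x y. g (x + y) = g x + g y) \<and> (\<forall>x y. g (x * y) = g x * g y)
     \<and> (\<forall>c. g (of_pol (const_pol c)) = of_pol (const_pol c))"

lemma field_automorphism_alt: "field_automorphism g \<longleftrightarrow> bij g \<and> field_hom g"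
  by (auto simp: field_automorphism_def field_hom_def)

lemma field_hom_simps:
  assumes "field_hom g"
  shows "g (x + y) = g x + g y" "g (x * y) = g x * g y" "g (of_pol (const_pol c)) = of_pol (const_pol c)"
    "g 0 = 0" "g 1 = 1" "g (- x) = - g x" "g (x - y) = g x - g y"
    "g (inverse x) = inverse (g x)" "g (x / y) = g x / g y" "g x = 0 \<longleftrightarrow> x = 0"
proof -
  show add: "g (x + y) = g x + g y" and mult: "g (x * y) = g x * g y"
    and const_pol: "g (of_pol (const_pol c)) = of_pol (const_pol c)" for x y c
    using assms by (auto simp: field_hom_def)
  show zero: "g 0 = 0" and one: "g 1 = 1" using const_pol [of 0] const_pol [of 1] by (simp_all add: C_simps)
  show minus: "g (- x) = - g x" for x
    using add [of x "- x"] by (simp add: zero eq_neg_iff_add_eq_0 add.commute)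
  show "g (x - y) = g x - g y" using add [of x "- y"] by (simp add: minus)
  have inv: "g x * g (inverse x) = 1" if "x \<noteq> 0" for x
    using mult [of x "inverse x"] that by (simp add: one)
  show inverse: "g (inverse x) = inverse (g x)" for x
  proof (cases "x = 0")
    case True
    then show ?thesis by (simp add: zero)
  next
    case False
    then show ?thesis using inv [OF False] by (metis inverse_unique)
  qed
  show "g (x / y) = g x / g y" by (simp add: divide_inverse mult inverse)
  show "g x = 0 \<longleftrightarrow> x = 0" using inv [of x] zero by fastforce
qed

lemma field_hom_comp: "field_hom g \<Longrightarrow> field_hom h \<Longrightarrow> field_hom (g \<circ> h)"
  by (simp add: field_hom_def)

lemma field_hom_id: "field_hom id"
  by (simp add: field_hom_def)

lemma field_hom_eqI:
  assumes g: "field_hom g" and h: "field_hom h" and eq: "\<And>v. g (of_pol (indet v)) = h (of_pol (indet v))"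
  shows "g = h"
proof
  fix x
  have *: "g (of_pol p) = h (of_pol p)" for p
    by (induction p rule: pol_induct) (simp_all add: field_hom_simps [OF g] field_hom_simps [OF h] eq)
  show "g x = h x"
    by (cases x)
      (simp add: Fract_of_pol * field_hom_simps(9) [OF g] field_hom_simps(9) [OF h])
qed

lemma field_hom_extend:
  assumes inj: "\<And>p. pol_subst \<sigma> p = 0 \<Longrightarrow> p = 0"
  shows "\<exists>g. field_hom g \<and> (\<forall>v. g (of_pol (indet v)) = \<sigma> v)"
proof -
  define g where "g x = (SOME y. \<exists>a b. b \<noteq> 0 \<and> x = Fract a b \<and> y = pol_subst \<sigma> a / pol_subst \<sigma> b)" for x
  have g: "g (Fract a b) = pol_subst \<sigma> a / pol_subst \<sigma> b" if b: "b \<noteq> 0" for a b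
  proof -
    have "\<exists>a' b'. b' \<noteq> 0 \<and> Fract a b = Fract a' b' \<and> g (Fract a b) = pol_subst \<sigma> a' / pol_subst \<sigma> b'"
      unfolding g_def by (rule someI_ex) (use b in blast)
    then obtain a' b' where b': "b' \<noteq> 0" and "Fract a b = Fract a' b'"
      and eq: "g (Fract a b) = pol_subst \<sigma> a' / pol_subst \<sigma> b'" by blast
    then have "a * b' = a' * b" using b by (simp add: eq_fract)
    then have "pol_subst \<sigma> a * pol_subst \<sigma> b' = pol_subst \<sigma> a' * pol_subst \<sigma> b" by (metis subst_mult)
    moreover have "pol_subst \<sigma> b \<noteq> 0" "pol_subst \<sigma> b' \<noteq> 0" using b b' inj by blast+
    ultimately show ?thesis using eq by (simp add: frac_eq_eq)
  qed
  have g': "g (of_pol p) = pol_subst \<sigma> p" for p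
    by (simp add: of_pol_def g subst_1)
  have nz: "pol_subst \<sigma> b \<noteq> 0" if "b \<noteq> 0" for b using inj that by blast
  have "g (x + y) = g x + g y" for x y
    by (cases x; cases y) (simp add: g subst_add subst_mult nz field_simps)
  moreover have "g (x * y) = g x * g y" for x y
    by (cases x; cases y) (simp add: g subst_mult)
  ultimately have "field_hom g"
    by (simp add: field_hom_def g' subst_C)
  moreover have "g (of_pol (indet v)) = \<sigma> v" for v by (simp add: g' subst_X)
  ultimately show ?thesis by blast
qed

lemma s_gen_inj:
  assumes "pol_subst (s_gen i) p = 0"
  shows "p = 0"
proof -
  define h where "h = pol_subst (s_gen i)"
  define D where "D = indet (Fvar i) * indet (Tau i)"
  note h = subst_add [of "s_gen i", folded h_def] subst_mult [of "s_gen i", folded h_def]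
    subst_C [of "s_gen i", folded h_def] subst_X [of "s_gen i", folded h_def]
    subst_1 [of "s_gen i", folded h_def] subst_uminus [of "s_gen i", folded h_def]
    subst_diff [of "s_gen i", folded h_def] subst_power [of "s_gen i", folded h_def]
  have hD: "h D \<noteq> 0" by (simp add: D_def h)
  have "\<exists>N n. h p * of_pol (D ^ n) = of_pol N \<and> h N = of_pol p * h (D ^ n)"
  proof (induction p rule: pol_induct)
    case (const_pol c)
    show ?case by (rule exI [of _ "const_pol c"], rule exI [of _ 0]) (simp add: h)
  next
    case (indet v)
    have "\<exists>N. h (indet v) * of_pol D = of_pol N \<and> h N = of_pol (indet v) * h D"
    proof (cases v)
      case (Alpha j)
      define N where "N = (if j = i then - indet (Alpha i)
        else if j = i + 1 \<or> j = i - 1 then indet (Alpha j) + indet (Alpha i) else indet (Alpha j)) * D"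
      show ?thesis
        by (rule exI [of _ N]) (simp add: Alpha N_def h \<alpha>_K_def)
    next
      case (Fvar j)
      define N where "N = (if j = i + 1 then indet (Fvar j) * indet (Fvar i) + indet (Alpha i)
        else if j = i - 1 then indet (Fvar j) * indet (Fvar i) - indet (Alpha i)
        else indet (Fvar j) * indet (Fvar i)) * indet (Tau i)"
      show ?thesis
        by (rule exI [of _ N]) (simp add: Fvar N_def D_def h \<alpha>_K_def f_K_def field_simps)
    next
      case (Tau j)
      define N where "N = (if j = i then indet (Fvar i) * indet (Fvar i) * indet (Tau (i - 1)) * indet (Tau (i + 1))
        else indet (Tau j) * D)"
      show ?thesis
        by (rule exI [of _ N]) (simp add: Tau N_def D_def h f_K_def \<tau>_K_def field_simps)
    qed
    then show ?case by (metis power_one_right)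
  next
    case (add p q)
    then obtain N1 n1 N2 n2 where *: "h p * of_pol (D ^ n1) = of_pol N1" "h N1 = of_pol p * h (D ^ n1)"
      "h q * of_pol (D ^ n2) = of_pol N2" "h N2 = of_pol q * h (D ^ n2)" by blast
    show ?case
    proof (intro exI conjI)
      show "h (p + q) * of_pol (D ^ (n1 + n2)) = of_pol (N1 * D ^ n2 + N2 * D ^ n1)"
        unfolding of_pol_simps *(1,3) [symmetric] by (simp add: h algebra_simps power_add)
      show "h (N1 * D ^ n2 + N2 * D ^ n1) = of_pol (p + q) * h (D ^ (n1 + n2))"
        by (simp add: h(1,2) *(2,4) algebra_simps power_add)
    qed
  next
    case (mult p q)
    then obtain N1 n1 N2 n2 where *: "h p * of_pol (D ^ n1) = of_pol N1" "h N1 = of_pol p * h (D ^ n1)"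
      "h q * of_pol (D ^ n2) = of_pol N2" "h N2 = of_pol q * h (D ^ n2)" by blast
    show ?case
    proof (intro exI conjI)
      show "h (p * q) * of_pol (D ^ (n1 + n2)) = of_pol (N1 * N2)"
        unfolding of_pol_simps *(1,3) [symmetric] by (simp add: h algebra_simps power_add)
      show "h (N1 * N2) = of_pol (p * q) * h (D ^ (n1 + n2))"
        by (simp add: h(2) *(2,4) algebra_simps power_add)
    qed
  qed
  then obtain N n where N: "h p * of_pol (D ^ n) = of_pol N" and hN: "h N = of_pol p * h (D ^ n)"
    by blast
  from N assms have "N = 0" by (simp add: h_def)
  with hN have "of_pol p * h D ^ n = 0" by (simp add: h_def subst_0 subst_power)
  with hD show ?thesis by simp
qed

lemma s_ex1: "\<exists>!g. field_automorphism g \<and> (\<forall>v. g (of_pol (indet v)) = s_gen i v)"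
proof -
  obtain g where g: "field_hom g" and gX: "\<And>v. g (of_pol (indet v)) = s_gen i v"
    using field_hom_extend [of "s_gen i"] s_gen_inj by blast
  have gen: "g (\<alpha>_K j) = s_gen i (Alpha j)" "g (f_K j) = s_gen i (Fvar j)" "g (\<tau>_K j) = s_gen i (Tau j)" for j
    using gX by (simp_all only: \<alpha>_K_def f_K_def \<tau>_K_def)
  have "g (g (of_pol (indet v))) = of_pol (indet v)" for v
    by (cases v)
      (auto simp: gX gen field_hom_simps [OF g] simp flip: \<alpha>_K_def f_K_def \<tau>_K_def)
  then have "g \<circ> g = id"
    by (intro field_hom_eqI field_hom_comp g field_hom_id) simp
  then have "bij g" using o_bij by blast
  with g gX have "field_automorphism g \<and> (\<forall>v. g (of_pol (indet v)) = s_gen i v)"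
    by (simp add: field_automorphism_alt)
  then show ?thesis
    using g gX by (intro ex1I [of _ g]) (auto intro!: field_hom_eqI simp: field_automorphism_alt)
qed

lemma s_hom: "field_hom (s_K i)" and s_X: "s_K i (of_pol (indet v)) = s_gen i v"
  using theI' [OF s_ex1 [of i]] unfolding s_K_def [symmetric] by (simp_all add: field_automorphism_alt)

lemmas s_simps [simp] = field_hom_simps [OF s_hom]

lemma s_gens [simp]: "s_K i (\<alpha>_K j) = s_gen i (Alpha j)" "s_K i (f_K j) = s_gen i (Fvar j)"
  "s_K i (\<tau>_K j) = s_gen i (Tau j)"
  unfolding \<alpha>_K_def f_K_def \<tau>_K_def by (rule s_X)+

lemma field_hom_gens_eqI:
  assumes "field_hom g" "field_hom h"
    and "\<And>j. g (\<alpha>_K j) = h (\<alpha>_K j)" "\<And>j. g (f_K j) = h (f_K j)" "\<And>j. g (\<tau>_K j) = h (\<tau>_K j)"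
  shows "g = h"
proof (rule field_hom_eqI)
  fix v
  show "g (of_pol (indet v)) = h (of_pol (indet v))"
    by (cases v) (use assms in \<open>simp_all add: \<alpha>_K_def f_K_def \<tau>_K_def\<close>)
qed (fact assms)+

lemma s_involution: "s_K i \<circ> s_K i = id"
  by (intro field_hom_gens_eqI field_hom_comp s_hom field_hom_id) auto

lemma s_commute:
  assumes "j \<noteq> i + 1" "j \<noteq> i - 1"
  shows "s_K i \<circ> s_K j = s_K j \<circ> s_K i"
  by (intro field_hom_gens_eqI field_hom_comp s_hom field_hom_id) (use assms in \<open>auto simp: add.commute\<close>)

lemma s_braid: "s_K i \<circ> s_K (i + 1) \<circ> s_K i = s_K (i + 1) \<circ> s_K i \<circ> s_K (i + 1)"
proof -
  define j where "j = i + 1"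
  define a where "a = i - 1"
  define b where "b = i + 2"
  note [simp del] = s_gens
  have [simp]: "s_K i (\<alpha>_K i) = - \<alpha>_K i" "s_K i (\<alpha>_K j) = \<alpha>_K j + \<alpha>_K i" "s_K j (\<alpha>_K j) = - \<alpha>_K j" "s_K j (\<alpha>_K i) = \<alpha>_K i + \<alpha>_K j"
    "s_K i (f_K i) = f_K i" "s_K i (f_K a) = f_K a - \<alpha>_K i / f_K i" "s_K i (f_K b) = f_K b"
    "s_K j (f_K j) = f_K j" "s_K j (f_K b) = f_K b + \<alpha>_K j / f_K j" "s_K j (f_K a) = f_K a"
    "s_K i (\<tau>_K a) = \<tau>_K a" "s_K i (\<tau>_K j) = \<tau>_K j" "s_K i (\<tau>_K b) = \<tau>_K b"
    "s_K j (\<tau>_K a) = \<tau>_K a" "s_K j (\<tau>_K i) = \<tau>_K i" "s_K j (\<tau>_K b) = \<tau>_K b"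
    "s_K i (\<tau>_K i) = f_K i * \<tau>_K a * \<tau>_K j / \<tau>_K i" "s_K j (\<tau>_K j) = f_K j * \<tau>_K i * \<tau>_K b / \<tau>_K j"
    by (simp_all add: a_def b_def j_def s_gens add.commute)
  have f_K: "s_K i (f_K j) = f_K j + \<alpha>_K i / f_K i" "s_K j (f_K i) = f_K i - \<alpha>_K j / f_K j"
    by (simp_all add: j_def s_gens)
  define P where "P = f_K i * f_K j - \<alpha>_K j"
  define Q where "Q = f_K i * f_K j + \<alpha>_K i"
  have sf [simp]: "s_K i (f_K j) = Q / f_K i" "s_K j (f_K i) = P / f_K j"
    by (simp_all add: P_def Q_def f_K field_simps)
  have sPQ [simp]: "s_K i P = P" "s_K j Q = Q" "s_K i Q = f_K i * f_K j" "s_K j P = f_K i * f_K j"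
    unfolding P_def Q_def by (simp_all add: f_K field_simps del: sf)
  have nz [simp]: "P \<noteq> 0" "Q \<noteq> 0"
  proof -
    have "s_K j (f_K i) \<noteq> 0" "s_K i (f_K j) \<noteq> 0" by (simp_all only: s_simps gens_neq_0 not_False_eq_True)
    then show "P \<noteq> 0" "Q \<noteq> 0" by auto
  qed
  have "s_K i (s_K j (s_K i (\<alpha>_K k))) = s_K j (s_K i (s_K j (\<alpha>_K k)))" for k
    by (auto simp: j_def s_gens add.commute)
  moreover have "s_K i (s_K j (s_K i (f_K k))) = s_K j (s_K i (s_K j (f_K k)))" for k
  proof -
    consider "k = i" | "k = j" | "k = a" | "k = b" | "k \<notin> {i, j, a, b}" by blast
    then show ?thesis
    proof cases
      case 3
      have "s_K j (s_K i (f_K a)) = f_K a - (\<alpha>_K i + \<alpha>_K j) * f_K j / P"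
        by (simp add: field_simps)
      moreover from this have "s_K i (s_K j (s_K i (f_K a))) = f_K a - \<alpha>_K i / f_K i - \<alpha>_K j * Q / (f_K i * P)"
        by (simp add: field_simps)
      moreover have "\<alpha>_K i / f_K i + \<alpha>_K j * Q / (f_K i * P) = (\<alpha>_K i + \<alpha>_K j) * f_K j / P"
        by (simp add: divide_simps) (simp add: P_def Q_def algebra_simps)
      ultimately show ?thesis by (simp add: 3 algebra_simps)
    next
      case 4
      have "s_K i (s_K j (f_K b)) = f_K b + (\<alpha>_K i + \<alpha>_K j) * f_K i / Q"
        by (simp add: field_simps)
      moreover from this have "s_K j (s_K i (s_K j (f_K b))) = f_K b + \<alpha>_K j / f_K j + \<alpha>_K i * P / (f_K j * Q)"
        by (simp add: field_simps)
      moreover have "\<alpha>_K j / f_K j + \<alpha>_K i * P / (f_K j * Q) = (\<alpha>_K i + \<alpha>_K j) * f_K i / Q"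
        by (simp add: divide_simps) (simp add: P_def Q_def algebra_simps)
      ultimately show ?thesis by (simp add: 4 algebra_simps)
    next
      case 5
      then have "s_K i (f_K k) = f_K k" "s_K j (f_K k) = f_K k"
        by (auto simp: s_gens a_def b_def j_def)
      then show ?thesis by simp
    qed simp_all
  qed
  moreover have "s_K i (s_K j (s_K i (\<tau>_K k))) = s_K j (s_K i (s_K j (\<tau>_K k)))" for k
  proof -
    consider "k = i" | "k = j" | "k \<notin> {i, j}" by blast
    then show ?thesis
    proof cases
      case 1
      have "s_K j (s_K i (\<tau>_K i)) = P * \<tau>_K a * \<tau>_K b / \<tau>_K j" by simp
      then show ?thesis unfolding 1 by simp
    next
      case 2
      have "s_K i (s_K j (\<tau>_K j)) = Q * \<tau>_K a * \<tau>_K b / \<tau>_K i" by simp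
      then show ?thesis unfolding 2 by simp
    next
      case 3
      then show ?thesis by (simp add: s_gens)
    qed
  qed
  ultimately have "s_K i \<circ> s_K j \<circ> s_K i = s_K j \<circ> s_K i \<circ> s_K j"
    by (intro field_hom_gens_eqI field_hom_comp s_hom field_hom_id) simp_all
  then show ?thesis by (simp add: j_def)
qed

lemma s_braid_power: "(s_K i \<circ> s_K (i + 1)) ^^ 3 = id"
proof -
  have "(s_K i \<circ> s_K (i + 1)) ^^ 3 = (s_K i \<circ> s_K (i + 1) \<circ> s_K i) \<circ> (s_K (i + 1) \<circ> s_K i \<circ> s_K (i + 1))"
    by (simp add: numeral_3_eq_3 o_assoc)
  also have "\<dots> = s_K i \<circ> (s_K (i + 1) \<circ> (s_K i \<circ> s_K i) \<circ> s_K (i + 1)) \<circ> s_K i"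
    by (simp only: s_braid [symmetric] o_assoc)
  finally show ?thesis by (simp add: s_involution)
qed

section \<open>The weight lattice\<close>

type_synonym weight = "int \<Rightarrow>\<^sub>0 int"

definition \<Lambda> :: "int \<Rightarrow> weight" where
  "\<Lambda> i = frag_of i"

definition s_wt :: "int \<Rightarrow> weight \<Rightarrow> weight" where
  "s_wt i = frag_extend (\<lambda>j. if j = i then \<Lambda> (i + 1) + \<Lambda> (i - 1) - \<Lambda> i else \<Lambda> j)"

lemma s_wt_simps:
  "s_wt i (x + y) = s_wt i x + s_wt i y" "s_wt i (x - y) = s_wt i x - s_wt i y"
  "s_wt i (\<Lambda> j) = (if j = i then \<Lambda> (i + 1) + \<Lambda> (i - 1) - \<Lambda> i else \<Lambda> j)"
  by (simp_all add: s_wt_def frag_extend_add frag_extend_diff \<Lambda>_def)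

definition wt_additive :: "(weight \<Rightarrow> weight) \<Rightarrow> bool" where
  "wt_additive g \<longleftrightarrow> (\<forall>x y. g (x - y) = g x - g y)"

lemma additive_s_wt: "wt_additive (s_wt i)" and additive_id: "wt_additive id"
  and additive_comp: "wt_additive g \<Longrightarrow> wt_additive h \<Longrightarrow> wt_additive (g \<circ> h)"
  by (simp_all add: wt_additive_def s_wt_simps)

lemma additive_eqI:
  assumes g: "wt_additive g" and h: "wt_additive h" and eq: "\<And>i. g (\<Lambda> i) = h (\<Lambda> i)"
  shows "g = h"
proof
  fix x
  have "g 0 = 0" "h 0 = 0"
    using g h unfolding wt_additive_def by (metis diff_self)+
  with assms show "g x = h x"
    by (induction x rule: frag_induction [OF subset_UNIV]) (auto simp: wt_additive_def \<Lambda>_def)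
qed

lemma s_wt_involution: "s_wt i \<circ> s_wt i = id"
  by (intro additive_eqI additive_comp additive_s_wt additive_id) (auto simp: s_wt_simps)

lemma s_wt_commute:
  assumes "j \<noteq> i + 1" "j \<noteq> i - 1"
  shows "s_wt i \<circ> s_wt j = s_wt j \<circ> s_wt i"
  by (intro additive_eqI additive_comp additive_s_wt additive_id)
    (use assms in \<open>auto simp: s_wt_simps\<close>)

lemma s_wt_braid_power: "(s_wt i \<circ> s_wt (i + 1)) ^^ 3 = id"
  unfolding numeral_3_eq_3 funpow.simps
  by (intro additive_eqI additive_comp additive_s_wt additive_id) (auto simp: s_wt_simps add.commute)

section \<open>The Weyl group \<open>W(A\<^sub>\<infinity>)\<close>\<close>

text \<open>
  Words in the generators modulo the congruence generated by the Coxeter relations. Since every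
  generator is its own inverse, this quotient of the free monoid is the Coxeter group.
\<close>

inductive coxeter_relation :: "int list \<Rightarrow> int list \<Rightarrow> bool" where
  "coxeter_relation [i, i] []"
| "coxeter_relation [i, i + 1, i, i + 1, i, i + 1] []"
| "j \<noteq> i + 1 \<Longrightarrow> j \<noteq> i - 1 \<Longrightarrow> coxeter_relation [i, j] [j, i]"

inductive coxeter_cong :: "int list \<Rightarrow> int list \<Rightarrow> bool" where
  rel: "coxeter_relation u v \<Longrightarrow> coxeter_cong (a @ u @ b) (a @ v @ b)"
| refl: "coxeter_cong u u"
| sym: "coxeter_cong u v \<Longrightarrow> coxeter_cong v u"
| trans: "coxeter_cong u v \<Longrightarrow> coxeter_cong v w \<Longrightarrow> coxeter_cong u w"

quotient_type weyl = "int list" / coxeter_cong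
  by (rule equivpI)
    (auto intro!: reflpI sympI transpI intro: coxeter_cong.intros)

lemma coxeter_cong_append:
  assumes "coxeter_cong u u'" "coxeter_cong v v'"
  shows "coxeter_cong (u @ v) (u' @ v')"
proof -
  have "coxeter_cong (x @ u @ y) (x @ u' @ y)" if "coxeter_cong u u'" for u u' x y
    using that
  proof induction
    case (rel u v a b)
    then show ?case using coxeter_cong.rel [of u v "x @ a" "b @ y"] by simp
  qed (auto intro: coxeter_cong.intros)
  from this [OF assms(1), of "[]" v] this [OF assms(2), of u' "[]"]
  show ?thesis by (auto intro: coxeter_cong.trans)
qed

lemma coxeter_cong_rev:
  assumes "coxeter_cong u v"
  shows "coxeter_cong (rev u) (rev v)"
  using assms
proof induction
  case (rel u v a b)
  have "coxeter_cong (rev u) (rev v)"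
    using rel
  proof cases
    case (1 i)
    then show ?thesis using coxeter_cong.rel [OF rel, of "[]" "[]"] by simp
  next
    case (2 i)
    let ?j = "i + 1"
    have c: "coxeter_cong (x @ [k, k] @ y) (x @ y)" for x y k
      using coxeter_cong.rel [OF coxeter_relation.intros(1) [of k], of x y] by simp
    have "coxeter_cong ([?j, i, ?j, i, ?j, i] @ [i, ?j, i, ?j, i, ?j]) ([?j, i, ?j, i, ?j, i] @ [])"
      by (rule coxeter_cong_append) (use coxeter_cong.rel [OF rel, of "[]" "[]"] 2 in \<open>auto intro: refl\<close>)
    moreover have "coxeter_cong ([?j, i, ?j, i, ?j, i] @ [i, ?j, i, ?j, i, ?j]) []"
      using c [of "[?j, i, ?j, i, ?j]" i "[?j, i, ?j, i, ?j]"]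
        c [of "[?j, i, ?j, i]" ?j "[i, ?j, i, ?j]"] c [of "[?j, i, ?j]" i "[?j, i, ?j]"]
        c [of "[?j, i]" ?j "[i, ?j]"] c [of "[?j]" i "[?j]"] c [of "[]" ?j "[]"]
      by simp (blast intro: coxeter_cong.trans)
    ultimately show ?thesis using 2 by (auto intro: coxeter_cong.sym coxeter_cong.trans)
  next
    case (3 j i)
    then show ?thesis
      using coxeter_cong.sym [OF coxeter_cong.rel [OF rel, of "[]" "[]"]] by simp
  qed
  then show ?case by (auto intro!: coxeter_cong_append refl)
qed (auto intro: coxeter_cong.intros)

instantiation weyl :: monoid_mult
begin

lift_definition one_weyl :: weyl is "[]" .

lift_definition times_weyl :: "weyl \<Rightarrow> weyl \<Rightarrow> weyl" is "(@)"
  by (rule coxeter_cong_append)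

instance
  by standard (transfer, simp add: coxeter_cong.refl)+

end

lift_definition weyl_inverse :: "weyl \<Rightarrow> weyl" is rev
  by (rule coxeter_cong_rev)

lemma weyl_left_inverse: "weyl_inverse w * w = 1"
proof transfer
  fix w :: "int list"
  show "coxeter_cong (rev w @ w) []"
  proof (induction w)
    case (Cons i w)
    then show ?case
      using coxeter_cong.rel [OF coxeter_relation.intros(1) [of i], of "rev w" w]
      by (auto intro: coxeter_cong.trans)
  qed (simp add: coxeter_cong.refl)
qed

lemma word_action_respects:
  fixes t :: "int \<Rightarrow> 'a \<Rightarrow> 'a"
  assumes "\<And>i. t i \<circ> t i = id" "\<And>i. (t i \<circ> t (i + 1)) ^^ 3 = id"
    and "\<And>i j. j \<noteq> i + 1 \<Longrightarrow> j \<noteq> i - 1 \<Longrightarrow> t i \<circ> t j = t j \<circ> t i"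
    and "coxeter_cong u v"
  shows "foldr t u = foldr t v"
  using assms(4)
proof induction
  case (rel u v a b)
  from rel have "foldr t u = foldr t v"
    by cases (use assms(1-3) in \<open>auto simp: numeral_3_eq_3 o_assoc\<close>)
  then show ?case by (simp add: fun_eq_iff)
qed auto

text \<open>A product of generators acts as the composition of their actions, the last one first.\<close>

lift_definition act :: "weyl \<Rightarrow> K \<Rightarrow> K" is "\<lambda>u. foldr s_K u"
  by (rule word_action_respects) (rule s_involution s_braid_power s_commute | assumption)+

lift_definition act_wt :: "weyl \<Rightarrow> weight \<Rightarrow> weight" is "\<lambda>u. foldr s_wt u"
  by (rule word_action_respects) (rule s_wt_involution s_wt_braid_power s_wt_commute | assumption)+

lemma act_1: "act 1 = id" and act_mult: "act (w * w') = act w \<circ> act w'"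
  and act_wt_1: "act_wt 1 = id" and act_wt_mult: "act_wt (w * w') = act_wt w \<circ> act_wt w'"
  by (transfer; simp add: fun_eq_iff)+

section \<open>Maya diagrams and Young diagrams\<close>

definition v_wt :: "int \<Rightarrow> weight" where
  "v_wt i = \<Lambda> i - \<Lambda> (i - 1)"

definition weyl_perm :: "weyl \<Rightarrow> int \<Rightarrow> int" where
  "weyl_perm w j = (THE k. act_wt w (v_wt j) = v_wt k)"

lemma v_wt_eq_iff: "v_wt i = v_wt j \<longleftrightarrow> i = j"
proof
  assume "v_wt i = v_wt j"
  then have "lookup (v_wt i) i = lookup (v_wt j) i" "lookup (v_wt i) j = lookup (v_wt j) j" by simp_all
  then show "i = j" by (auto simp: v_wt_def \<Lambda>_def lookup_minus split: if_splits)
qed simp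

lemma s_wt_v: "s_wt i (v_wt j) = v_wt (if j = i then i + 1 else if j = i + 1 then i else j)"
  by (auto simp: v_wt_def s_wt_simps)

lemma act_wt_v: "act_wt w (v_wt j) = v_wt (weyl_perm w j)"
proof -
  have "\<exists>k. act_wt w (v_wt j) = v_wt k"
  proof (transfer fixing: j)
    fix u :: "int list"
    show "\<exists>k. foldr s_wt u (v_wt j) = v_wt k"
      by (induction u) (auto simp: s_wt_v)
  qed
  then have "\<exists>!k. act_wt w (v_wt j) = v_wt k" by (auto simp: v_wt_eq_iff)
  then show ?thesis unfolding weyl_perm_def by (rule theI')
qed

definition maya :: "weyl \<Rightarrow> int set" where
  "maya w = weyl_perm w ` {..0}"

definition is_partition :: "nat list \<Rightarrow> bool" where
  "is_partition l \<longleftrightarrow> sorted_wrt (\<ge>) l \<and> 0 \<notin> set l"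

text \<open>Nodes and parts are numbered from \<open>1\<close>, lists from \<open>0\<close>.\<close>

definition young :: "nat list \<Rightarrow> (nat \<times> nat) set" where
  "young l = {(i, j). 1 \<le> i \<and> i \<le> length l \<and> 1 \<le> j \<and> j \<le> l ! (i - 1)}"

definition part :: "nat list \<Rightarrow> nat \<Rightarrow> nat" where
  "part l i = card {j. (i, j) \<in> young l}"

definition transposed_part :: "nat list \<Rightarrow> nat \<Rightarrow> nat" where
  "transposed_part l j = card {i. (i, j) \<in> young l}"

lemma part_nth: "1 \<le> i \<Longrightarrow> i \<le> length l \<Longrightarrow> part l i = l ! (i - 1)"
proof -
  assume "1 \<le> i" "i \<le> length l"
  then have "{j. (i, j) \<in> young l} = {1..l ! (i - 1)}" by (auto simp: young_def)
  then show ?thesis by (simp add: part_def)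
qed

text \<open>The disjunct \<open>n = 0\<close> makes the value \<open>0\<close> for the empty partition, as \<open>Max {}\<close> is unspecified.\<close>

definition durfee :: "nat list \<Rightarrow> nat" where
  "durfee l = Max {n. n = 0 \<or> n \<le> length l \<and> n \<le> part l n}"

definition frobenius_I :: "nat list \<Rightarrow> int set" where
  "frobenius_I l = (\<lambda>n. int (part l n) - int n + 1) ` {1..durfee l}"

definition frobenius_J :: "nat list \<Rightarrow> int set" where
  "frobenius_J l = (\<lambda>n. int (transposed_part l n) - int n) ` {1..durfee l}"

definition partition_of :: "weyl \<Rightarrow> nat list" where
  "partition_of w = (THE l. is_partition l \<and> frobenius_I l = maya w \<inter> {0<..}
      \<and> uminus ` frobenius_J l = {..0} - maya w)"

definition color :: "nat \<times> nat \<Rightarrow> int" where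
  "color = (\<lambda>(i, j). int j - int i)"

definition num_nodes :: "weyl \<Rightarrow> int \<Rightarrow> nat" where
  "num_nodes w i = card {y \<in> young (partition_of w). color y = i}"

section \<open>The functions \<open>\<phi>\<^sub>w(\<Lambda>\<^sub>0)\<close> and leading terms\<close>

text \<open>
  \<open>Prod_any g\<close> and \<open>Sum_any g\<close> from the library are the product and the sum over all indices;
  they have their intended meaning when only finitely many terms are nontrivial, as is the case below.
\<close>

definition phi_Lambda0 :: "weyl \<Rightarrow> K" where
  "phi_Lambda0 w = act w (\<tau>_K 0) / Prod_any (\<lambda>i. \<tau>_K i powi lookup (act_wt w (\<Lambda> 0)) i)"

lemma phi_Lambda0_characterization:
  "act w (\<tau>_K 0) = phi_Lambda0 w * Prod_any (\<lambda>i. \<tau>_K i powi lookup (act_wt w (\<Lambda> 0)) i)"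
proof -
  have "Prod_any g \<noteq> 0" if "\<And>i. g i \<noteq> 0" for g :: "int \<Rightarrow> K"
    unfolding Prod_any.expand_set using that by (cases "finite {i. g i \<noteq> 1}") simp_all
  then show ?thesis by (simp add: phi_Lambda0_def)
qed

definition int_pol_alpha_f :: "pol set" where
  "int_pol_alpha_f = {p. \<forall>m\<in>keys p. lookup p m \<in> \<int> \<and> (\<forall>i. Tau i \<notin> keys m)}"

definition f_degree :: "mon \<Rightarrow> nat" where
  "f_degree m = Sum_any (\<lambda>i. lookup m (Fvar i))"

definition f_leading_term :: "pol \<Rightarrow> pol" where
  "f_leading_term p = (\<Sum>m | m \<in> keys p \<and> f_degree m = Max (f_degree ` keys p).
      Poly_Mapping.single m (lookup p m))"

end

(*
  Let X be the infinite upper triangular matrix with diagonal epsilon (alpha_i = epsilon_i - epsilon_{i+1}),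
  first superdiagonal f and second superdiagonal 1. On X the reflection s_i acts as the conjugation by
  1 + (alpha_i / f_i) E_{i+1,i}, so on the unitriangular matrix of eigenvectors of X it acts by a row
  operation, a transposition of two columns and a rescaling of these columns. Hence phi_w(Lambda_0) is,
  up to products of differences epsilon_r - epsilon_j, the minor of the eigenvector matrix with rows r <= 0
  and columns in the Maya diagram; in particular it has no poles along f_i = 0.

  On the other hand phi_{s_i w} = f_i^m s_i(phi_w), where m in {-1, 0, 1} is the change of the number of
  nodes of color i. As s_i alters f_{i+1} and f_{i-1} by alpha_i / f_i only, phi_{s_i w} lies in
  Z[alpha; f; 1/f_i] and its leading term is that of phi_w times f_i^m. Having no pole along f_i = 0,
  it is a polynomial.
*)
theory Submission
  imports Defs "Jordan_Normal_Form.Determinant"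
begin

section \<open>The recursion for \<open>\<phi>\<^sub>w(\<Lambda>\<^sub>0)\<close>\<close>

text \<open>Neither half suffices alone. Induction on words through \<open>phi_gen\<close> keeps
  track of integrality and degrees, but each letter may create negative powers of f_i, and nothing
  in the recursion shows that they cancel. The minors have no such poles, but their entries have
  differences of \<epsilon> as denominators, so integrality is not visible there. The two
  descriptions are therefore intersected after each letter, for arbitrary words, without a choice of
  reduced expressions. The coefficient \<alpha>_i / f_i is the one that keeps the conjugated matrix
  upper triangular: a coefficient g puts g (\<alpha>_i - g f_i) at position (i+1, i). The row
  operation adds a multiple of row i to row i+1, and the set of rows r <= 0 contains row i whenever
  it contains row i+1, so the minor survives. The two columns are rescaled by -\<alpha>_i / f_i and
  f_i / \<alpha>_i, and exactly these powers of f_i cancel against f_i^m.\<close>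

lift_definition weyl_gen :: "int \<Rightarrow> weyl" is "\<lambda>i. [i]" .

lemma act_weyl_gen: "act (weyl_gen i) = s_K i"
  by transfer (simp add: fun_eq_iff)

lemma act_wt_weyl_gen: "act_wt (weyl_gen i) = s_wt i"
  by transfer (simp add: fun_eq_iff)

text \<open>The letters \<open>i > k\<close> do not touch the part of the Maya diagram up to \<open>k\<close>, so finite minors suffice below.\<close>

inductive weyl_above :: "int \<Rightarrow> weyl \<Rightarrow> bool" for k where
  one: "weyl_above k 1"
| gen: "k < i \<Longrightarrow> weyl_above k w \<Longrightarrow> weyl_above k (weyl_gen i * w)"

lemma weyl_above_mono: "weyl_above k w \<Longrightarrow> k' \<le> k \<Longrightarrow> weyl_above k' w"
  by (induction rule: weyl_above.induct) (auto intro: weyl_above.intros)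

lemma weyl_induct [case_names one gen]:
  assumes "P 1" "\<And>i w. P w \<Longrightarrow> P (weyl_gen i * w)"
  shows "P w"
proof -
  have "P (abs_weyl u)" for u
  proof (induction u)
    case Nil
    then show ?case using assms(1) by (simp add: one_weyl_def)
  next
    case (Cons i u)
    have "weyl_gen i * abs_weyl u = abs_weyl (i # u)"
      by (simp add: weyl_gen_def times_weyl.abs_eq)
    with assms(2) [OF Cons, of i] show ?case by simp
  qed
  from this [of "rep_weyl w"] show ?thesis by (simp only: Quotient3_abs_rep [OF Quotient3_weyl])
qed

lemma ex_weyl_above: "\<exists>k\<le>0. weyl_above k w"
proof (induction w rule: weyl_induct)
  case one
  show ?case by (intro exI [of _ 0]) (simp add: weyl_above.one)
next
  case (gen i w)
  then obtain k where k: "k \<le> 0" "weyl_above k w" by blast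
  have "weyl_above (min k (i - 1)) (weyl_gen i * w)"
    using weyl_above_mono [OF k(2)] by (simp add: weyl_above.gen)
  then show ?case using k by (intro exI [of _ "min k (i - 1)"]) simp
qed

section \<open>Permutations, Maya diagrams and weights\<close>

definition adj_swap :: "int \<Rightarrow> int \<Rightarrow> int" where
  "adj_swap i j = (if j = i then i + 1 else if j = i + 1 then i else j)"

lemma adj_swap_invol [simp]: "adj_swap i (adj_swap i j) = j"
  by (simp add: adj_swap_def)

lemma inj_adj_swap: "inj (adj_swap i)"
  by (metis adj_swap_invol injI)

lemma weyl_perm_one [simp]: "weyl_perm 1 j = j"
  using act_wt_v [of 1 j] by (simp add: act_wt_1 v_wt_eq_iff)

lemma weyl_perm_gen: "weyl_perm (weyl_gen i * w) j = adj_swap i (weyl_perm w j)"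
  using act_wt_v [of "weyl_gen i * w" j]
  by (simp add: act_wt_mult act_wt_weyl_gen act_wt_v s_wt_v v_wt_eq_iff adj_swap_def)

lemma inj_weyl_perm: "inj (weyl_perm w)"
proof (induction w rule: weyl_induct)
  case one
  then show ?case by (simp add: inj_def)
next
  case (gen i w)
  have "weyl_perm (weyl_gen i * w) = adj_swap i \<circ> weyl_perm w"
    by (simp add: fun_eq_iff weyl_perm_gen)
  with inj_compose [OF inj_adj_swap gen] show ?case by metis
qed

lemma weyl_above_fixes: "weyl_above k w \<Longrightarrow> j \<le> k \<Longrightarrow> weyl_perm w j = j"
  by (induction rule: weyl_above.induct) (auto simp: weyl_perm_gen adj_swap_def)

lemma maya_one: "maya 1 = {..0}"
  by (simp add: maya_def)

lemma mem_maya_gen: "j \<in> maya (weyl_gen i * w) \<longleftrightarrow> adj_swap i j \<in> maya w"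
  unfolding maya_def weyl_perm_gen image_iff by (metis adj_swap_invol)

lemma lookup_s_wt:
  "lookup (s_wt i x) k = (if k = i then - lookup x i
     else if k = i + 1 \<or> k = i - 1 then lookup x k + lookup x i else lookup x k)"
proof (induction x rule: frag_induction [OF subset_UNIV])
  case 1
  then show ?case using s_wt_simps(2) [of i 0 0] by simp
next
  case (2 j)
  have "s_wt i (frag_of j) = (if j = i then \<Lambda> (i + 1) + \<Lambda> (i - 1) - \<Lambda> i else \<Lambda> j)"
    using s_wt_simps(3) [of i j] by (simp add: \<Lambda>_def)
  then show ?case by (auto simp: \<Lambda>_def lookup_add lookup_minus)
next
  case (3 a b)
  then show ?case by (auto simp: s_wt_simps lookup_minus)
qed

definition maya_jump :: "weyl \<Rightarrow> int \<Rightarrow> int" where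
  "maya_jump w i = of_bool (i \<in> maya w) - of_bool (i + 1 \<in> maya w)"

text \<open>In the formal sum of the \<open>v_wt j\<close> over the Maya diagram,
  \<open>\<Lambda> i\<close> enters positively through \<open>v_wt i\<close> and negatively through
  \<open>v_wt (i + 1)\<close>. As that sum is infinite, the proof is an induction on
  \<open>w\<close>.\<close>

lemma lookup_act_wt: "lookup (act_wt w (\<Lambda> 0)) i = maya_jump w i"
proof (induction w arbitrary: i rule: weyl_induct)
  case one
  then show ?case by (auto simp: act_wt_1 \<Lambda>_def lookup_single when_def maya_jump_def maya_one simp del: single_one)
next
  case (gen j w)
  then show ?case
    by (auto simp: act_wt_mult act_wt_weyl_gen lookup_s_wt maya_jump_def mem_maya_gen adj_swap_def)
qed

section \<open>Monomials in \<tau> and the recursion\<close>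

definition tau_monomial :: "weight \<Rightarrow> K" where
  "tau_monomial x = Prod_any (\<lambda>i. \<tau>_K i powi lookup x i)"

lemma finite_tau_exponents: "finite {i. \<tau>_K i powi lookup x i \<noteq> 1}"
  by (rule finite_subset [OF _ finite_keys [of x]]) (auto simp: in_keys_iff)

lemma tau_monomial_0: "tau_monomial 0 = 1"
  by (simp add: tau_monomial_def)

lemma tau_monomial_nz: "tau_monomial x \<noteq> 0"
  unfolding tau_monomial_def Prod_any.expand_set using finite_tau_exponents by simp

lemma tau_monomial_diff: "tau_monomial (x - y) = tau_monomial x / tau_monomial y"
proof -
  have "tau_monomial (x - y) * tau_monomial y = tau_monomial x"
    unfolding tau_monomial_def
    by (subst Prod_any.distrib [symmetric], (rule finite_tau_exponents)+)
      (simp add: lookup_minus power_int_diff)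
  then show ?thesis using tau_monomial_nz [of y] by (simp add: field_simps)
qed

lemma tau_monomial_Lambda: "tau_monomial (\<Lambda> i) = \<tau>_K i"
proof -
  have "tau_monomial (\<Lambda> i) = Prod_any (\<lambda>j. if j = i then \<tau>_K i else 1)"
    unfolding tau_monomial_def by (rule Prod_any.cong) (simp add: \<Lambda>_def lookup_single when_def)
  then show ?thesis by (simp add: Prod_any.delta)
qed

lemma tau_monomial_add: "tau_monomial (x + y) = tau_monomial x * tau_monomial y"
  using tau_monomial_diff [of "x + y" y] by (simp add: tau_monomial_nz field_simps)

text \<open>Both sides are multiplicative in \<open>x\<close>, so the basis suffices; there only
  \<open>\<tau>_K i\<close> moves, and each power of it brings one power of
  \<open>f_K i\<close>.\<close>

lemma s_K_tau_monomial: "s_K i (tau_monomial x) = f_K i powi lookup x i * tau_monomial (s_wt i x)"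
proof (induction x rule: frag_induction [OF subset_UNIV])
  case 1
  show ?case using s_wt_simps(2) [of i 0 0] by (simp add: tau_monomial_0)
next
  case (2 j)
  have 1: "s_wt i (frag_of j) = (if j = i then \<Lambda> (i + 1) + \<Lambda> (i - 1) - \<Lambda> i else \<Lambda> j)"
    using s_wt_simps(3) [of i j] by (simp add: \<Lambda>_def)
  have 2: "tau_monomial (frag_of j) = \<tau>_K j" using tau_monomial_Lambda by (simp add: \<Lambda>_def)
  show ?case unfolding 1 2
    by (simp add: tau_monomial_diff tau_monomial_add tau_monomial_Lambda lookup_single when_def)
next
  case (3 a b)
  then show ?case
    by (simp add: tau_monomial_diff s_wt_simps lookup_minus power_int_diff)
qed

lemma phi_one: "phi_Lambda0 1 = 1"
  using tau_monomial_Lambda [of 0]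
  by (simp add: phi_Lambda0_def act_1 act_wt_1 tau_monomial_def)

lemma phi_gen: "phi_Lambda0 (weyl_gen i * w) = f_K i powi maya_jump w i * s_K i (phi_Lambda0 w)"
proof -
  let ?x = "act_wt w (\<Lambda> 0)"
  have "act (weyl_gen i * w) (\<tau>_K 0) = s_K i (act w (\<tau>_K 0))"
    by (simp add: act_mult act_weyl_gen)
  also have "\<dots> = s_K i (phi_Lambda0 w) * s_K i (tau_monomial ?x)"
    using phi_Lambda0_characterization [of w] by (simp flip: tau_monomial_def)
  also have "\<dots> = s_K i (phi_Lambda0 w) * (f_K i powi maya_jump w i * tau_monomial (s_wt i ?x))"
    by (simp add: s_K_tau_monomial lookup_act_wt)
  finally show ?thesis
    by (simp add: phi_Lambda0_def act_wt_mult act_wt_weyl_gen tau_monomial_nz flip: tau_monomial_def)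
qed

section \<open>The eigenvector matrix\<close>

definition alpha_pols :: "pol set" where
  "alpha_pols = {p. \<forall>m\<in>keys p. keys m \<subseteq> range Alpha}"

lemma alpha_pols_add: "p \<in> alpha_pols \<Longrightarrow> q \<in> alpha_pols \<Longrightarrow> p + q \<in> alpha_pols"
  using Poly_Mapping.keys_add [of p q] by (auto simp: alpha_pols_def)

lemma alpha_pols_uminus: "p \<in> alpha_pols \<Longrightarrow> - p \<in> alpha_pols"
  by (simp add: alpha_pols_def)

lemma alpha_pols_mult:
  assumes "p \<in> alpha_pols" "q \<in> alpha_pols"
  shows "p * q \<in> alpha_pols"
  unfolding alpha_pols_def
proof (intro CollectI ballI)
  fix m assume "m \<in> keys (p * q)"
  then obtain a b where "a \<in> keys p" "b \<in> keys q" "m = a + b"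
    using keys_mult [of p q] by auto
  then show "keys m \<subseteq> range Alpha"
    using assms Poly_Mapping.keys_add [of a b] unfolding alpha_pols_def by blast
qed

lemma alpha_pols_0: "0 \<in> alpha_pols" and alpha_pols_one: "1 \<in> alpha_pols"
  by (simp_all add: alpha_pols_def)

lemma alpha_pols_indet: "indet (Alpha i) \<in> alpha_pols"
  by (simp add: alpha_pols_def indet_def)

lemma alpha_pols_sum: "(\<And>x. x \<in> A \<Longrightarrow> g x \<in> alpha_pols) \<Longrightarrow> sum g A \<in> alpha_pols"
  by (induction A rule: infinite_finite_induct) (auto intro: alpha_pols_add alpha_pols_0)

text \<open>The elements of \<open>\<complex>(\<alpha>)[f; \<tau>]\<close>: these have no pole along any \<open>f\<^sub>i = 0\<close>.\<close>

definition alpha_denom :: "K set" where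
  "alpha_denom = {x. \<exists>h\<in>alpha_pols. h \<noteq> 0 \<and> (\<exists>q. of_pol h * x = of_pol q)}"

lemma alpha_denomI: "h \<in> alpha_pols \<Longrightarrow> h \<noteq> 0 \<Longrightarrow> of_pol h * x = of_pol q \<Longrightarrow> x \<in> alpha_denom"
  by (auto simp: alpha_denom_def)

lemma alpha_denom_of_pol: "of_pol p \<in> alpha_denom"
  by (rule alpha_denomI [of 1]) (auto intro: alpha_pols_one)

lemma alpha_denom_mult:
  assumes "x \<in> alpha_denom" "y \<in> alpha_denom"
  shows "x * y \<in> alpha_denom"
proof -
  from assms obtain h p h' p' where h: "h \<in> alpha_pols" "h \<noteq> 0" "of_pol h * x = of_pol p"
    "h' \<in> alpha_pols" "h' \<noteq> 0" "of_pol h' * y = of_pol p'" unfolding alpha_denom_def by blast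
  have "of_pol (h * h') * (x * y) = (of_pol h * x) * (of_pol h' * y)"
    by (simp add: mult_ac)
  then have "of_pol (h * h') * (x * y) = of_pol (p * p')"
    using h by simp
  moreover have "h * h' \<in> alpha_pols" "h * h' \<noteq> 0" using h by (simp_all add: alpha_pols_mult)
  ultimately show ?thesis by (rule alpha_denomI [rotated 2])
qed

lemma alpha_denom_add:
  assumes "x \<in> alpha_denom" "y \<in> alpha_denom"
  shows "x + y \<in> alpha_denom"
proof -
  from assms obtain h p h' p' where h: "h \<in> alpha_pols" "h \<noteq> 0" "of_pol h * x = of_pol p"
    "h' \<in> alpha_pols" "h' \<noteq> 0" "of_pol h' * y = of_pol p'" unfolding alpha_denom_def by blast
  have "of_pol (h * h') * (x + y) = of_pol h' * (of_pol h * x) + of_pol h * (of_pol h' * y)"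
    by (simp add: algebra_simps)
  then have "of_pol (h * h') * (x + y) = of_pol (h' * p + h * p')"
    using h by simp
  moreover have "h * h' \<in> alpha_pols" "h * h' \<noteq> 0" using h by (simp_all add: alpha_pols_mult)
  ultimately show ?thesis by (rule alpha_denomI [rotated 2])
qed

lemma alpha_denom_0: "0 \<in> alpha_denom" and alpha_denom_1: "1 \<in> alpha_denom"
  using alpha_denom_of_pol [of 0] alpha_denom_of_pol [of 1] by simp_all

lemma alpha_denom_uminus: "x \<in> alpha_denom \<Longrightarrow> - x \<in> alpha_denom"
  using alpha_denom_mult [of "of_pol (- 1)" x] alpha_denom_of_pol [of "- 1"] by simp

lemma alpha_denom_sum: "(\<And>x. x \<in> A \<Longrightarrow> g x \<in> alpha_denom) \<Longrightarrow> sum g A \<in> alpha_denom"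
  by (induction A rule: infinite_finite_induct) (auto intro: alpha_denom_add alpha_denom_0)

lemma alpha_denom_prod: "(\<And>x. x \<in> A \<Longrightarrow> g x \<in> alpha_denom) \<Longrightarrow> prod g A \<in> alpha_denom"
  by (induction A rule: infinite_finite_induct) (auto intro: alpha_denom_mult alpha_denom_1)

text \<open>The coordinates \<open>\<epsilon>\<^sub>j\<close> with \<open>\<alpha>\<^sub>j = \<epsilon>\<^sub>j - \<epsilon>\<^sub>j\<^sub>+\<^sub>1\<close>, normalised by \<open>\<epsilon>\<^sub>0 = 0\<close>.\<close>

definition eps_pol :: "int \<Rightarrow> pol" where
  "eps_pol j = (if 0 \<le> j then - (\<Sum>k\<in>{0..<j}. indet (Alpha k)) else (\<Sum>k\<in>{j..<0}. indet (Alpha k)))"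

definition eps :: "int \<Rightarrow> K" where
  "eps j = of_pol (eps_pol j)"

lemma eps_pol_step: "eps_pol j - eps_pol (j + 1) = indet (Alpha j)"
proof -
  consider "0 \<le> j" | "j = -1" | "j < -1" by linarith
  then show ?thesis
  proof cases
    case 1
    then have "{0..<j + 1} = insert j {0..<j}" by auto
    with 1 show ?thesis by (simp add: eps_pol_def)
  next
    case 2
    have "{-1..<0::int} = {-1}" by auto
    with 2 show ?thesis by (simp add: eps_pol_def)
  next
    case 3
    then have "{j..<0} = insert j {j + 1..<0}" by auto
    with 3 show ?thesis by (simp add: eps_pol_def)
  qed
qed

lemma eps_step: "eps j - eps (j + 1) = \<alpha>_K j"
  using eps_pol_step [of j] by (simp only: eps_def \<alpha>_K_def of_pol_simps(4) [symmetric])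

lemma eps_pol_mem: "eps_pol j \<in> alpha_pols"
  by (auto simp: eps_pol_def intro!: alpha_pols_uminus alpha_pols_sum alpha_pols_indet)

lemma eps_pol_diff:
  assumes "r \<le> j"
  shows "eps_pol r - eps_pol j = (\<Sum>k\<in>{r..<j}. indet (Alpha k))"
  using assms
proof (induction j rule: int_ge_induct)
  case base
  then show ?case by simp
next
  case (step j)
  have "{r..<j + 1} = insert j {r..<j}" using step by auto
  with step eps_pol_step [of j] show ?case by (simp add: algebra_simps)
qed

text \<open>For r < j the difference is \<alpha>_r + ... + \<alpha>_{j-1}, in which \<alpha>_r has
  coefficient 1. Thus X has distinct eigenvalues.\<close>

lemma eps_pol_inj: "eps_pol r = eps_pol j \<longleftrightarrow> r = j"
proof -
  have less: "eps_pol r \<noteq> eps_pol j" if "r < j" for r j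
  proof -
    have "lookup (\<Sum>k\<in>{r..<j}. indet (Alpha k)) (Poly_Mapping.single (Alpha r) 1)
        = (\<Sum>k\<in>{r..<j}. if k = r then 1 else 0)"
      unfolding lookup_sum indet_def
    proof (rule sum.cong)
      fix k
      have "Poly_Mapping.single (Alpha k) (1::nat) = Poly_Mapping.single (Alpha r) 1 \<longleftrightarrow> k = r"
        by (metis gen.inject(1) lookup_single_eq lookup_single_not_eq one_neq_zero)
      then show "lookup (Poly_Mapping.single (Poly_Mapping.single (Alpha k) (1::nat)) (1::complex)) (Poly_Mapping.single (Alpha r) 1)
          = (if k = r then 1 else 0)"
        by (simp add: lookup_single when_def)
    qed simp
    also have "\<dots> \<noteq> 0" using that by simp
    finally show ?thesis using eps_pol_diff [of r j] that by auto
  qed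
  show ?thesis using less [of r j] less [of j r] by (metis linorder_neqE)
qed

lemma eps_inj: "eps r = eps j \<longleftrightarrow> r = j"
  by (simp add: eps_def eps_pol_inj)

text \<open>The normalisation \<open>eps 0 = 0\<close> is not respected by transpositions, so the
  reflection permutes the \<epsilon> only up to a common translation \<open>d\<close>. That
  \<open>d\<close> is constant is the formula for the action on the \<alpha>.\<close>

lemma s_K_eps_diff: "s_K i (eps r) - s_K i (eps j) = eps (adj_swap i r) - eps (adj_swap i j)"
proof -
  define d where "d r = s_K i (eps r) - eps (adj_swap i r)" for r
  have step: "d (r + 1) = d r" for r
  proof -
    have "s_K i (eps r) - s_K i (eps (r + 1)) = s_K i (\<alpha>_K r)"
      by (simp only: s_simps(7) [symmetric] eps_step)
    also have "\<dots> = eps (adj_swap i r) - eps (adj_swap i (r + 1))"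
    proof -
      consider "r = i - 1" | "r = i" | "r = i + 1" | "r \<notin> {i - 1, i, i + 1}" by blast
      then show ?thesis
        using eps_step [of "i - 1"] eps_step [of i] eps_step [of "i + 1"] eps_step [of r]
        by cases (auto simp: adj_swap_def algebra_simps)
    qed
    finally show ?thesis by (simp add: d_def algebra_simps)
  qed
  have "d r = d 0" for r
  proof (induction r rule: int_induct [of _ 0])
    case (step1 i)
    then show ?case by (simp add: step)
  next
    case (step2 i)
    then show ?case using step [of "i - 1"] by simp
  qed simp
  from this [of r] this [of j] have "d r = d j" by simp
  then show ?thesis by (simp add: d_def algebra_simps)
qed

text \<open>All differences of the \<epsilon> are generators, not only the \<alpha>: reflections
  permute these differences, and the denominators of \<open>eigen_col\<close> are among
  them.\<close>

inductive_set alpha_units :: "K set" where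
  one: "1 \<in> alpha_units"
| uminus: "x \<in> alpha_units \<Longrightarrow> - x \<in> alpha_units"
| mult: "x \<in> alpha_units \<Longrightarrow> y \<in> alpha_units \<Longrightarrow> x * y \<in> alpha_units"
| inverse: "x \<in> alpha_units \<Longrightarrow> inverse x \<in> alpha_units"
| eps: "r \<noteq> j \<Longrightarrow> eps r - eps j \<in> alpha_units"

lemma alpha_units_alpha: "\<alpha>_K i \<in> alpha_units"
  using alpha_units.eps [of i "i + 1"] by (simp add: eps_step)

lemma alpha_units_s_K: "x \<in> alpha_units \<Longrightarrow> s_K i x \<in> alpha_units"
proof (induction rule: alpha_units.induct)
  case (eps r j)
  then have "adj_swap i r \<noteq> adj_swap i j" by (metis adj_swap_invol)
  then show ?case by (simp add: s_K_eps_diff alpha_units.eps)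
qed (auto intro: alpha_units.intros)

lemma alpha_units_denom: "x \<in> alpha_units \<Longrightarrow> x \<in> alpha_denom"
proof -
  assume "x \<in> alpha_units"
  \<comment> \<open>Numerator and denominator are both kept nonzero and free of f and \<tau>, so
    that inverses are covered by exchanging them.\<close>
  then have "\<exists>h\<in>alpha_pols. \<exists>h'\<in>alpha_pols. h \<noteq> 0 \<and> h' \<noteq> 0 \<and> x = of_pol h' / of_pol h"
  proof (induction rule: alpha_units.induct)
    case one
    show ?case by (intro bexI [of _ 1]) (auto simp: alpha_pols_one)
  next
    case (uminus x)
    then obtain h h' where h: "h \<in> alpha_pols" "h' \<in> alpha_pols" "h \<noteq> 0" "h' \<noteq> 0" "x = of_pol h' / of_pol h"
      by blast
    show ?case
      by (intro bexI [of _ h] bexI [of _ "- h'"]) (use h in \<open>simp_all add: alpha_pols_uminus\<close>)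
  next
    case (mult x y)
    then obtain h h' g g' where h: "h \<in> alpha_pols" "h' \<in> alpha_pols" "h \<noteq> 0" "h' \<noteq> 0" "x = of_pol h' / of_pol h"
        "g \<in> alpha_pols" "g' \<in> alpha_pols" "g \<noteq> 0" "g' \<noteq> 0" "y = of_pol g' / of_pol g"
      by blast
    show ?case
      by (intro bexI [of _ "h * g"] bexI [of _ "h' * g'"]) (use h in \<open>simp_all add: alpha_pols_mult\<close>)
  next
    case (inverse x)
    then show ?case by (auto simp: inverse_divide)
  next
    case (eps r j)
    show ?case
      by (intro bexI [of _ 1] bexI [of _ "eps_pol r - eps_pol j"])
        (use eps alpha_pols_add [OF eps_pol_mem alpha_pols_uminus [OF eps_pol_mem], of r j]
         in \<open>auto simp: eps_def eps_pol_inj alpha_pols_one\<close>)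
  qed
  then show "x \<in> alpha_denom" by (auto intro!: alpha_denomI)
qed

text \<open>
  \<open>eigen_mat\<close> is the upper unitriangular matrix whose \<open>j\<close>-th column spans the \<open>\<epsilon>\<^sub>j\<close>-eigenspace of
  the upper triangular matrix \<open>X\<close> with diagonal \<open>\<epsilon>\<close>, first superdiagonal \<open>f\<close> and second
  superdiagonal \<open>1\<close>. The action of \<open>s\<^sub>i\<close> on \<open>X\<close> is the conjugation by \<open>1 + (\<alpha>\<^sub>i / f\<^sub>i) E\<^sub>i\<^sub>+\<^sub>1\<^sub>,\<^sub>i\<close>.
\<close>

fun eigen_col :: "int \<Rightarrow> nat \<Rightarrow> K" where
  "eigen_col j 0 = 1"
| "eigen_col j (Suc 0) = f_K (j - 1) / (eps j - eps (j - 1))"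
| "eigen_col j (Suc (Suc n)) = (f_K (j - int n - 2) * eigen_col j (Suc n) + eigen_col j n)
     / (eps j - eps (j - int n - 2))"

definition eigen_mat :: "int \<Rightarrow> int \<Rightarrow> K" where
  "eigen_mat r j = (if r \<le> j then eigen_col j (nat (j - r)) else 0)"

lemma eigen_mat_diag: "eigen_mat j j = 1" and eigen_mat_lower: "j < r \<Longrightarrow> eigen_mat r j = 0"
  by (simp_all add: eigen_mat_def)

text \<open>Row \<open>r\<close> of X u = \<epsilon>_j u. At r = j the left factor is 0, and below
  the diagonal all entries vanish, so no restriction on \<open>r\<close> is needed.\<close>

lemma eigen_mat_rec:
  "(eps j - eps r) * eigen_mat r j = f_K r * eigen_mat (r + 1) j + eigen_mat (r + 2) j"
proof -
  consider "j \<le> r" | "r = j - 1" | n where "r = j - int n - 2"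
    using that(3) [of "nat (j - r - 2)"] by linarith
  then show ?thesis
  proof cases
    case 1
    then show ?thesis by (simp add: eigen_mat_def)
  next
    case 2
    then show ?thesis by (simp add: eigen_mat_def eps_inj)
  next
    case 3
    have "nat (j - r) = Suc (Suc n)" "nat (j - (r + 1)) = Suc n" "nat (j - (r + 2)) = n"
      using 3 by simp_all
    then have "eigen_mat r j = (f_K r * eigen_mat (r + 1) j + eigen_mat (r + 2) j) / (eps j - eps r)"
      using 3 by (simp add: eigen_mat_def)
    moreover have "eps j - eps r \<noteq> 0" using 3 by (simp add: eps_inj)
    ultimately show ?thesis by simp
  qed
qed

lemma eigen_mat_denom: "eigen_mat r j \<in> alpha_denom"
proof -
  have div: "x / (eps j - eps k) \<in> alpha_denom" if "x \<in> alpha_denom" "k \<noteq> j" for x j k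
    unfolding divide_inverse using that
    by (intro alpha_denom_mult [OF _ alpha_units_denom [OF alpha_units.inverse [OF alpha_units.eps]]]) auto
  have "eigen_col j n \<in> alpha_denom" for n
    by (induction j n rule: eigen_col.induct)
      (auto intro!: div alpha_denom_add alpha_denom_mult alpha_denom_of_pol simp: f_K_def alpha_denom_1)
  then show ?thesis by (simp add: eigen_mat_def alpha_denom_0)
qed

text \<open>For r < j the recurrence can be divided by \<open>c r\<close>, so the rows from
  \<open>j\<close> on determine all rows above them.\<close>

lemma triangular_recurrence_unique:
  fixes y z :: "int \<Rightarrow> 'a::field"
  assumes y: "\<And>r. c r * y r = g r * y (r + 1) + y (r + 2)"
    and z: "\<And>r. c r * z r = g r * z (r + 1) + z (r + 2)"
    and nz: "\<And>r. r < j \<Longrightarrow> c r \<noteq> 0"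
    and eq: "\<And>r. j \<le> r \<Longrightarrow> y r = z r"
  shows "y r = z r"
proof -
  have "\<forall>r\<ge>j - int n. y r = z r" for n
  proof (induction n)
    case 0
    then show ?case using eq by simp
  next
    case (Suc n)
    show ?case
    proof (intro allI impI)
      fix r assume r: "j - int (Suc n) \<le> r"
      show "y r = z r"
      proof (cases "r < j - int n")
        case True
        with r have "y (r + 1) = z (r + 1)" "y (r + 2) = z (r + 2)" using Suc by auto
        then have "c r * y r = c r * z r" using y z by simp
        then show ?thesis using True nz [of r] by simp
      next
        case False
        then show ?thesis using Suc by simp
      qed
    qed
  qed
  from this [of "nat (j - r)"] show ?thesis by simp
qed

text \<open>After the row operation and the transposition, columns i and i+1 have diagonal entries
  -f_i / \<alpha>_i and \<alpha>_i / f_i; the inverses of these restore the diagonal entry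
  1.\<close>

definition eigen_factor :: "int \<Rightarrow> int \<Rightarrow> K" where
  "eigen_factor i j = (if j = i then - \<alpha>_K i / f_K i else if j = i + 1 then f_K i / \<alpha>_K i else 1)"

text \<open>The entries of (1 + (\<alpha>_i / f_i) E_{i+1,i}) U, with U the eigenvector
  matrix.\<close>

definition eigen_row_op :: "int \<Rightarrow> int \<Rightarrow> int \<Rightarrow> K" where
  "eigen_row_op i r k = eigen_mat r k + (if r = i + 1 then \<alpha>_K i / f_K i * eigen_mat i k else 0)"

text \<open>Conjugating X turns its eigenvectors into eigenvectors of the conjugate, whose diagonal
  entries i and i+1 are exchanged. Only rows i-1, i and i+1 differ from
  \<open>eigen_mat_rec\<close>; in the last two the identity g f_i = \<alpha>_i makes the terms
  match.\<close>

lemma eigen_row_op_rec: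
  "(eps k - eps (adj_swap i r)) * eigen_row_op i r k
     = s_K i (f_K r) * eigen_row_op i (r + 1) k + eigen_row_op i (r + 2) k"
proof -
  define g where "g = \<alpha>_K i / f_K i"
  have gf: "g * f_K i = \<alpha>_K i" by (simp add: g_def)
  note rec = eigen_mat_rec [of k]
  have al: "\<alpha>_K i = eps i - eps (i + 1)" by (simp add: eps_step)
  consider "r = i + 1" | "r = i" | "r = i - 1" | "r \<notin> {i, i + 1, i - 1}" by blast
  then show ?thesis
  proof cases
    case 1
    have "(eps k - eps i) * (eigen_mat (i + 1) k + g * eigen_mat i k)
        = (eps k - eps (i + 1)) * eigen_mat (i + 1) k - \<alpha>_K i * eigen_mat (i + 1) k
          + g * ((eps k - eps i) * eigen_mat i k)"
      unfolding al by (simp add: algebra_simps)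
    also have "\<dots> = f_K (i + 1) * eigen_mat (i + 2) k + eigen_mat (i + 3) k
        - \<alpha>_K i * eigen_mat (i + 1) k + (g * f_K i) * eigen_mat (i + 1) k + g * eigen_mat (i + 2) k"
      unfolding rec by (simp add: algebra_simps)
    also have "\<dots> = (f_K (i + 1) + g) * eigen_mat (i + 2) k + eigen_mat (i + 3) k"
      unfolding gf by (simp add: algebra_simps)
    finally show ?thesis
      unfolding 1 by (simp add: eigen_row_op_def adj_swap_def add.commute [of _ i] flip: g_def)
  next
    case 2
    have "(eps k - eps (i + 1)) * eigen_mat i k = (eps k - eps i) * eigen_mat i k + \<alpha>_K i * eigen_mat i k"
      unfolding al by (simp add: algebra_simps)
    also have "\<dots> = f_K i * (eigen_mat (i + 1) k + g * eigen_mat i k) + eigen_mat (i + 2) k"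
      unfolding rec gf [symmetric] by (simp add: algebra_simps)
    finally show ?thesis
      unfolding 2 by (simp add: eigen_row_op_def adj_swap_def flip: g_def)
  next
    case 3
    have "(eps k - eps (i - 1)) * eigen_mat (i - 1) k
        = (f_K (i - 1) - g) * eigen_mat i k + (eigen_mat (i + 1) k + g * eigen_mat i k)"
      unfolding rec by (simp add: algebra_simps)
    then show ?thesis
      unfolding 3 by (simp add: eigen_row_op_def adj_swap_def add.commute [of 1 i] flip: g_def)
  next
    case 4
    then have "adj_swap i r = r" "s_K i (f_K r) = f_K r" "eigen_row_op i r k = eigen_mat r k"
      "eigen_row_op i (r + 1) k = eigen_mat (r + 1) k" "eigen_row_op i (r + 2) k = eigen_mat (r + 2) k"
      by (auto simp: eigen_row_op_def adj_swap_def)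
    then show ?thesis using rec [of r] by (simp only:)
  qed
qed

text \<open>Both sides solve the recurrence of the reflected matrix, so only rows r >= j have to be
  compared. Column \<open>j\<close> comes from column \<open>adj_swap i j\<close> because the
  reflection exchanges the eigenvalues.\<close>

lemma s_K_eigen_mat: "s_K i (eigen_mat r j) = eigen_factor i j * eigen_row_op i r (adj_swap i j)"
proof (rule triangular_recurrence_unique [where j = j
      and y = "\<lambda>r. s_K i (eigen_mat r j)"
      and z = "\<lambda>r. eigen_factor i j * eigen_row_op i r (adj_swap i j)" and c = "\<lambda>r. s_K i (eps j - eps r)"
      and g = "\<lambda>r. s_K i (f_K r)"])
  fix r
  show "s_K i (eps j - eps r) * s_K i (eigen_mat r j)
      = s_K i (f_K r) * s_K i (eigen_mat (r + 1) j) + s_K i (eigen_mat (r + 2) j)"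
    using arg_cong [OF eigen_mat_rec [of j r], of "s_K i"] by (simp only: s_simps)
  show "s_K i (eps j - eps r) * (eigen_factor i j * eigen_row_op i r (adj_swap i j))
      = s_K i (f_K r) * (eigen_factor i j * eigen_row_op i (r + 1) (adj_swap i j))
        + eigen_factor i j * eigen_row_op i (r + 2) (adj_swap i j)"
    using arg_cong [OF eigen_row_op_rec [of "adj_swap i j" i r], of "\<lambda>x. eigen_factor i j * x"]
    by (simp only: s_simps(7) s_K_eps_diff) (simp only: algebra_simps)
  show "s_K i (eps j - eps r) \<noteq> 0" if "r < j"
    using that by (simp only: s_simps(10)) (simp add: eps_inj)
  \<comment> \<open>With this value 1 + (\<alpha>_i / f_i) U_{i,i+1} = 0: the row operation clears
    row i+1 of column i+1, as required below the diagonal of the reflected column i.\<close>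
  have U1: "eigen_mat i (i + 1) = - (f_K i / \<alpha>_K i)"
  proof -
    have "- \<alpha>_K i * eigen_mat i (i + 1) = f_K i"
      using eigen_mat_rec [of "i + 1" i] by (simp add: eigen_mat_diag eigen_mat_lower flip: eps_step)
    then show ?thesis by (simp add: field_simps minus_equation_iff)
  qed
  assume "j \<le> r"
  consider "j = i" | "j = i + 1" | "j \<noteq> i" "j \<noteq> i + 1" by blast
  then show "s_K i (eigen_mat r j) = eigen_factor i j * eigen_row_op i r (adj_swap i j)"
  proof cases
    case 1
    consider "r = i" | "r = i + 1" | "i + 1 < r" using \<open>j \<le> r\<close> 1 by linarith
    then show ?thesis
      by cases (simp_all add: 1 eigen_mat_diag eigen_mat_lower eigen_factor_def eigen_row_op_def
          adj_swap_def U1)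
  next
    case 2
    consider "r = i + 1" | "i + 1 < r" using \<open>j \<le> r\<close> 2 by linarith
    then show ?thesis
      by cases (simp_all add: 2 eigen_mat_diag eigen_mat_lower eigen_factor_def eigen_row_op_def
          adj_swap_def)
  next
    case 3
    consider "r = j" | "j < r" using \<open>j \<le> r\<close> by linarith
    then show ?thesis
      by cases (use 3 in \<open>simp_all add: eigen_mat_diag eigen_mat_lower eigen_factor_def
          eigen_row_op_def adj_swap_def\<close>)
  qed
qed

section \<open>Minors\<close>

lemma det_scale_columns:
  fixes c :: "nat \<Rightarrow> 'a::comm_ring_1"
  shows "det (mat n n (\<lambda>(i, j). c j * A i j)) = (\<Prod>j<n. c j) * det (mat n n (\<lambda>(i, j). A i j))"
proof -
  have "of_int (sign p) * (\<Prod>i = 0..<n. c (p i) * A i (p i))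
      = (\<Prod>j<n. c j) * (of_int (sign p) * (\<Prod>i = 0..<n. A i (p i)))" if "p permutes {0..<n}" for p
  proof -
    have "(\<Prod>i = 0..<n. c (p i)) = (\<Prod>j<n. c j)"
      using prod.permute [OF that, of c] by (simp add: lessThan_atLeast0)
    then show ?thesis by (simp add: prod.distrib mult_ac)
  qed
  moreover have "p i < n" if "p permutes {0..<n}" "i < n" for p i
    using permutes_in_image [OF that(1), of i] that(2) by simp
  ultimately show ?thesis
    by (simp add: Determinant.det_def sum_distrib_left)
qed

text \<open>
  The minor of the eigenvector matrix with rows \<open>-n < r \<le> 0\<close> whose columns are the elements of
  the Maya diagram above \<open>-n\<close>.
\<close>

definition maya_minor :: "nat \<Rightarrow> weyl \<Rightarrow> K" where
  "maya_minor n w = det (mat n n (\<lambda>(r, c). eigen_mat (- int r) (weyl_perm w (- int c))))"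

lemma maya_minor_one: "maya_minor n 1 = 1"
proof -
  let ?A = "mat n n (\<lambda>(r, c). eigen_mat (- int r) (- int c))"
  \<comment> \<open>Rows and columns are numbered downwards from 0, which turns upper triangular
    into lower triangular.\<close>
  have "det ?A = prod_list (diag_mat ?A)"
    by (rule det_lower_triangular [of n]) (auto simp: eigen_mat_lower)
  also have "diag_mat ?A = replicate n 1"
    by (rule nth_equalityI) (auto simp: diag_mat_def eigen_mat_diag)
  finally show ?thesis by (simp add: maya_minor_def)
qed

lemma maya_minor_denom: "maya_minor n w \<in> alpha_denom"
proof -
  have "of_int (sign p) \<in> alpha_denom" for p :: "nat \<Rightarrow> nat"
    by (auto simp: sign_def alpha_denom_1 alpha_denom_uminus)
  moreover have "p i < n" if "p permutes {0..<n}" "i < n" for p i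
    using permutes_in_image [OF that(1), of i] that(2) by simp
  ultimately show ?thesis
    unfolding maya_minor_def Determinant.det_def
    by (auto intro!: alpha_denom_sum alpha_denom_mult alpha_denom_prod eigen_mat_denom)
qed

text \<open>For i >= 0 the altered row i+1 lies outside the minor; for i < 0 the added row i lies
  inside it, thanks to -n < i.\<close>

lemma det_eigen_row_op:
  assumes "- int n < i"
  shows "det (mat n n (\<lambda>(r, c). eigen_row_op i (- int r) (q c)))
    = det (mat n n (\<lambda>(r, c). eigen_mat (- int r) (q c)))" (is "det ?B = det ?A")
proof (cases "0 \<le> i")
  case True
  then have "?B = ?A" by (intro cong_mat) (auto simp: eigen_row_op_def)
  then show ?thesis by simp
next
  case False
  define l where "l = nat (- i)"
  have l: "l < n" "i = - int l" "0 < l" using assms False by (auto simp: l_def)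
  have "?B = addrow (\<alpha>_K i / f_K i) (l - 1) l ?A"
    by (rule eq_matI) (use l in \<open>auto simp: eigen_row_op_def add.commute of_nat_diff\<close>)
  then show ?thesis using l by (simp add: det_addrow [of l n])
qed

text \<open>The columns are listed through \<open>weyl_perm\<close>, so passing from
  \<open>w\<close> to \<open>weyl_gen i * w\<close> is itself the transposition of columns, and no
  sign appears.\<close>

lemma s_K_maya_minor:
  assumes "- int n < i"
  shows "s_K i (maya_minor n w)
    = (\<Prod>c<n. eigen_factor i (weyl_perm w (- int c))) * maya_minor n (weyl_gen i * w)"
proof -
  let ?A = "mat n n (\<lambda>(r, c). eigen_mat (- int r) (weyl_perm w (- int c)))"
  let ?B = "mat n n (\<lambda>(r, c). eigen_factor i (weyl_perm w (- int c))
      * eigen_row_op i (- int r) (weyl_perm (weyl_gen i * w) (- int c)))"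
  have "comm_ring_hom (s_K i)"
    by unfold_locales (rule s_simps(4) s_simps(1) s_simps(5) s_simps(2))+
  then have "s_K i (maya_minor n w) = det (map_mat (s_K i) ?A)"
    unfolding maya_minor_def by (rule comm_ring_hom.hom_det [symmetric])
  also have "map_mat (s_K i) ?A = ?B"
    by (rule eq_matI) (auto simp: s_K_eigen_mat weyl_perm_gen)
  also have "det ?B = (\<Prod>c<n. eigen_factor i (weyl_perm w (- int c)))
      * det (mat n n (\<lambda>(r, c). eigen_row_op i (- int r) (weyl_perm (weyl_gen i * w) (- int c))))"
    by (rule det_scale_columns [of n "\<lambda>c. eigen_factor i (weyl_perm w (- int c))"
          "\<lambda>r c. eigen_row_op i (- int r) (weyl_perm (weyl_gen i * w) (- int c))"])
  finally have scaled: "s_K i (maya_minor n w) = (\<Prod>c<n. eigen_factor i (weyl_perm w (- int c)))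
      * det (mat n n (\<lambda>(r, c). eigen_row_op i (- int r) (weyl_perm (weyl_gen i * w) (- int c))))" .
  have row_op: "det (mat n n (\<lambda>(r, c). eigen_row_op i (- int r) (weyl_perm (weyl_gen i * w) (- int c))))
      = maya_minor n (weyl_gen i * w)"
    unfolding maya_minor_def by (rule det_eigen_row_op [OF assms, of "\<lambda>c. weyl_perm (weyl_gen i * w) (- int c)"])
  show ?thesis using scaled unfolding row_op .
qed

text \<open>Up to units, column i contributes 1 / f_i and column i+1 contributes f_i, so the product
  carries f_i to the power \<open>- maya_jump w i\<close>.\<close>

lemma eigen_factor_prod:
  assumes "weyl_above (- int n) w" "- int n < i"
  shows "f_K i powi maya_jump w i * (\<Prod>c<n. eigen_factor i (weyl_perm w (- int c))) \<in> alpha_units"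
proof -
  define S where "S = (\<lambda>c. weyl_perm w (- int c)) ` {..<n}"
  have "inj_on (\<lambda>c. weyl_perm w (- int c)) {..<n}"
    by (auto simp: inj_on_def inj_eq [OF inj_weyl_perm])
  then have "(\<Prod>c<n. eigen_factor i (weyl_perm w (- int c))) = prod (eigen_factor i) S"
    by (simp add: S_def prod.reindex)
  also have "\<dots> = prod (eigen_factor i) (S \<inter> {i, i + 1})"
    by (rule prod.mono_neutral_right) (auto simp: S_def eigen_factor_def)
  also have "S \<inter> {i, i + 1} = maya w \<inter> {i, i + 1}"
  proof -
    \<comment> \<open>\<open>S\<close> omits only the images of indices c <= -n;
      \<open>weyl_perm w\<close> fixes these, so they are not above -n.\<close>
    have "j \<in> S \<longleftrightarrow> j \<in> maya w" if "- int n < j" for j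
    proof
      assume "j \<in> maya w"
      then obtain c where c: "c \<le> 0" "j = weyl_perm w c" by (auto simp: maya_def)
      then have "- int n < c" using weyl_above_fixes [OF assms(1), of c] that by force
      with c show "j \<in> S" unfolding S_def
        by (intro image_eqI [of _ _ "nat (- c)"]) auto
    qed (auto simp: S_def maya_def)
    then show ?thesis using assms(2) by auto
  qed
  finally have *: "(\<Prod>c<n. eigen_factor i (weyl_perm w (- int c))) = prod (eigen_factor i) (maya w \<inter> {i, i + 1})" .
  show ?thesis
  proof (cases "i \<in> maya w"; cases "i + 1 \<in> maya w")
    assume "i \<in> maya w" "i + 1 \<in> maya w"
    then have "maya w \<inter> {i, i + 1} = {i, i + 1}" by auto
    with \<open>i \<in> maya w\<close> \<open>i + 1 \<in> maya w\<close> show ?thesis unfolding *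
      by (simp add: maya_jump_def eigen_factor_def alpha_units.intros)
  next
    assume "i \<in> maya w" "i + 1 \<notin> maya w"
    then have "maya w \<inter> {i, i + 1} = {i}" by auto
    with \<open>i \<in> maya w\<close> \<open>i + 1 \<notin> maya w\<close> show ?thesis unfolding *
      by (simp add: maya_jump_def eigen_factor_def alpha_units.uminus alpha_units_alpha)
  next
    assume "i \<notin> maya w" "i + 1 \<in> maya w"
    then have "maya w \<inter> {i, i + 1} = {i + 1}" by auto
    with \<open>i \<notin> maya w\<close> \<open>i + 1 \<in> maya w\<close> show ?thesis unfolding *
      using alpha_units.inverse [OF alpha_units_alpha [of i]]
      by (simp add: maya_jump_def eigen_factor_def divide_inverse power_int_minus flip: mult.assoc)
  next
    assume "i \<notin> maya w" "i + 1 \<notin> maya w"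
    then have "maya w \<inter> {i, i + 1} = {}" by auto
    with \<open>i \<notin> maya w\<close> \<open>i + 1 \<notin> maya w\<close> show ?thesis unfolding *
      by (simp add: maya_jump_def alpha_units.one)
  qed
qed

lemma phi_eq_maya_minor:
  "weyl_above (- int n) w \<Longrightarrow> \<exists>x\<in>alpha_units. phi_Lambda0 w = x * maya_minor n w"
proof (induction w rule: weyl_above.induct)
  case one
  then show ?case by (intro bexI [of _ 1]) (simp_all add: phi_one maya_minor_one alpha_units.one)
next
  case (gen i w)
  then obtain x where x: "x \<in> alpha_units" "phi_Lambda0 w = x * maya_minor n w" by blast
  let ?y = "f_K i powi maya_jump w i * (\<Prod>c<n. eigen_factor i (weyl_perm w (- int c)))"
  have "phi_Lambda0 (weyl_gen i * w) = (s_K i x * ?y) * maya_minor n (weyl_gen i * w)"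
    by (simp add: phi_gen x(2) s_K_maya_minor [OF gen.hyps(1)] mult_ac)
  moreover have "s_K i x * ?y \<in> alpha_units"
    using gen x by (intro alpha_units.mult alpha_units_s_K eigen_factor_prod)
  ultimately show ?case by blast
qed

lemma phi_denom: "phi_Lambda0 w \<in> alpha_denom"
proof -
  obtain k where "k \<le> 0" "weyl_above k w" using ex_weyl_above by blast
  then have "weyl_above (- int (nat (- k))) w" by simp
  then show ?thesis
    using phi_eq_maya_minor alpha_units_denom maya_minor_denom alpha_denom_mult by metis
qed

section \<open>Degrees in \<open>f\<close>\<close>

lemma finite_Fvar_support: "finite {i. lookup m (Fvar i) \<noteq> (0::nat)}"
proof -
  have "{i. lookup m (Fvar i) \<noteq> 0} = Fvar -` keys m" by (auto simp: in_keys_iff)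
  moreover have "finite (Fvar -` keys m)" by (rule finite_vimageI) (auto simp: inj_def)
  ultimately show ?thesis by simp
qed

lemma f_degree_add: "f_degree (m + n) = f_degree m + f_degree n"
  unfolding f_degree_def lookup_add
  by (rule Sum_any.distrib) (rule finite_Fvar_support)+

lemma f_degree_0: "f_degree 0 = 0"
  by (simp add: f_degree_def)

lemma f_degree_single_Fvar: "f_degree (Poly_Mapping.single (Fvar i) n) = n"
proof -
  have "f_degree (Poly_Mapping.single (Fvar i) n) = Sum_any (\<lambda>j. if j = i then n else 0)"
    unfolding f_degree_def by (rule Sum_any.cong) (simp add: lookup_single when_def)
  then show ?thesis by (simp add: Sum_any.delta)
qed

lemma f_degree_single_Alpha: "f_degree (Poly_Mapping.single (Alpha i) n) = 0"
  by (simp add: f_degree_def lookup_single when_def)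

lemma mon_induct [case_names zero add]:
  fixes m :: "'a \<Rightarrow>\<^sub>0 nat"
  assumes zero: "P 0" and add: "\<And>m v. P m \<Longrightarrow> P (m + Poly_Mapping.single v 1)"
  shows "P m"
proof -
  have add_n: "P (m + Poly_Mapping.single v n)" if "P m" for m v n
  proof (induction n)
    case 0
    then show ?case using that by simp
  next
    case (Suc n)
    have "m + Poly_Mapping.single v (Suc n) = m + Poly_Mapping.single v n + Poly_Mapping.single v 1"
      by (simp add: add.assoc flip: single_add)
    then show ?case using add [OF Suc, of v] by simp
  qed
  have "P (\<Sum>v\<in>A. Poly_Mapping.single v (g v))" if "finite A" for A g
    using that
  proof (induction A rule: finite_induct)
    case (insert v A)
    then show ?case using add_n [OF insert.IH, of v "g v"] by (simp add: add.commute)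
  qed (simp add: zero)
  from this [OF finite_keys [of m], of "lookup m"] show ?thesis by (simp flip: pol_sum_single)
qed

text \<open>The bound \<open>d\<close> may be negative, in which case only the zero polynomial satisfies it.\<close>

definition int_pols :: "int \<Rightarrow> pol set" where
  "int_pols d = {p \<in> int_pol_alpha_f. \<forall>m\<in>keys p. int (f_degree m) \<le> d}"

lemma int_pols_iff:
  "p \<in> int_pols d \<longleftrightarrow> (\<forall>m. lookup p m \<in> \<int>)
     \<and> (\<forall>m\<in>keys p. (\<forall>i. Tau i \<notin> keys m) \<and> int (f_degree m) \<le> d)"
proof -
  have "(\<forall>m. lookup p m \<in> \<int>) \<longleftrightarrow> (\<forall>m\<in>keys p. lookup p m \<in> \<int>)"
    by (metis Ints_0 in_keys_iff)
  then show ?thesis by (auto simp: int_pols_def int_pol_alpha_f_def)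
qed

lemma int_pols_mono: "p \<in> int_pols d \<Longrightarrow> d \<le> e \<Longrightarrow> p \<in> int_pols e"
  by (force simp: int_pols_def)

lemma int_pols_0: "0 \<in> int_pols d"
  by (simp add: int_pols_iff)

lemma int_pols_single:
  "c \<in> \<int> \<Longrightarrow> (\<And>i. Tau i \<notin> keys m) \<Longrightarrow> int (f_degree m) \<le> d \<Longrightarrow> Poly_Mapping.single m c \<in> int_pols d"
  by (auto simp: int_pols_iff lookup_single when_def)

lemma int_pols_one: "1 \<in> int_pols 0"
  using int_pols_single [of 1 0 0] by (simp add: f_degree_0)

lemma int_pols_Alpha: "indet (Alpha i) \<in> int_pols 0"
  unfolding indet_def by (rule int_pols_single) (simp_all add: f_degree_single_Alpha)

lemma int_pols_Fvar_power: "indet (Fvar i) ^ n \<in> int_pols (int n)"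
proof -
  have "indet (Fvar i) ^ n = Poly_Mapping.single (Poly_Mapping.single (Fvar i) n) 1"
    by (induction n) (auto simp: indet_def mult_single single_add [symmetric])
  then show ?thesis by (simp add: int_pols_single f_degree_single_Fvar)
qed

lemma int_pols_add: "p \<in> int_pols d \<Longrightarrow> q \<in> int_pols d \<Longrightarrow> p + q \<in> int_pols d"
  using Poly_Mapping.keys_add [of p q] unfolding int_pols_iff by (auto simp: lookup_add)

lemma int_pols_uminus: "p \<in> int_pols d \<Longrightarrow> - p \<in> int_pols d"
  by (simp add: int_pols_iff)

lemma int_pols_sum: "(\<And>x. x \<in> A \<Longrightarrow> g x \<in> int_pols d) \<Longrightarrow> sum g A \<in> int_pols d"
  by (induction A rule: infinite_finite_induct) (auto intro: int_pols_add int_pols_0)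

lemma int_pols_mult:
  assumes p: "p \<in> int_pols d" and q: "q \<in> int_pols e"
  shows "p * q \<in> int_pols (d + e)"
proof -
  have "p * q = (\<Sum>m\<in>keys p. \<Sum>n\<in>keys q.
      Poly_Mapping.single m (lookup p m) * Poly_Mapping.single n (lookup q n))"
    by (subst pol_sum_single [of p], subst pol_sum_single [of q]) (rule sum_product)
  moreover have "Poly_Mapping.single m (lookup p m) * Poly_Mapping.single n (lookup q n) \<in> int_pols (d + e)"
    if "m \<in> keys p" "n \<in> keys q" for m n
    unfolding mult_single
  proof (rule int_pols_single)
    show "Tau i \<notin> keys (m + n)" for i
      using p q that Poly_Mapping.keys_add [of m n] unfolding int_pols_iff by blast
    have "int (f_degree m) \<le> d" "int (f_degree n) \<le> e" using p q that by (auto simp: int_pols_iff)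
    then show "int (f_degree (m + n)) \<le> d + e" by (simp add: f_degree_add)
  qed (use p q in \<open>auto simp: int_pols_iff\<close>)
  ultimately show ?thesis by (auto intro!: int_pols_sum)
qed

text \<open>Elements of \<open>\<int>[\<alpha>; f; 1/f\<^sub>i]\<close> of total degree at most \<open>d\<close> in \<open>f\<close>.\<close>

definition laurent :: "int \<Rightarrow> int \<Rightarrow> K set" where
  "laurent i d = {x. \<exists>N. \<exists>q\<in>int_pols (int N + d). f_K i ^ N * x = of_pol q}"

lemma laurentI: "q \<in> int_pols (int N + d) \<Longrightarrow> f_K i ^ N * x = of_pol q \<Longrightarrow> x \<in> laurent i d"
  by (auto simp: laurent_def)

lemma laurent_of_pol: "p \<in> int_pols d \<Longrightarrow> of_pol p \<in> laurent i d"
  by (rule laurentI [of p 0]) auto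

lemma laurent_mono: "x \<in> laurent i d \<Longrightarrow> d \<le> e \<Longrightarrow> x \<in> laurent i e"
  unfolding laurent_def by (force intro: int_pols_mono)

lemma laurent_mult:
  assumes "x \<in> laurent i d" "y \<in> laurent i e"
  shows "x * y \<in> laurent i (d + e)"
proof -
  from assms obtain N p M q where *: "p \<in> int_pols (int N + d)" "f_K i ^ N * x = of_pol p"
    "q \<in> int_pols (int M + e)" "f_K i ^ M * y = of_pol q" unfolding laurent_def by blast
  have "f_K i ^ (N + M) * (x * y) = (f_K i ^ N * x) * (f_K i ^ M * y)"
    by (simp add: power_add mult_ac)
  then have "f_K i ^ (N + M) * (x * y) = of_pol (p * q)" using * by simp
  moreover have "p * q \<in> int_pols (int (N + M) + (d + e))"
    using int_pols_mult [OF *(1,3)] by (simp add: algebra_simps)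
  ultimately show ?thesis by (rule laurentI [rotated])
qed

lemma laurent_add:
  assumes "x \<in> laurent i d" "y \<in> laurent i d"
  shows "x + y \<in> laurent i d"
proof -
  from assms obtain N p M q where *: "p \<in> int_pols (int N + d)" "f_K i ^ N * x = of_pol p"
    "q \<in> int_pols (int M + d)" "f_K i ^ M * y = of_pol q" unfolding laurent_def by blast
  let ?F = "indet (Fvar i)"
  have "f_K i ^ (N + M) * (x + y) = f_K i ^ M * (f_K i ^ N * x) + f_K i ^ N * (f_K i ^ M * y)"
    by (simp add: power_add algebra_simps)
  then have "f_K i ^ (N + M) * (x + y) = of_pol (?F ^ M * p + ?F ^ N * q)"
    using * by (simp add: f_K_def)
  moreover have "?F ^ M * p + ?F ^ N * q \<in> int_pols (int (N + M) + d)"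
    using int_pols_mult [OF int_pols_Fvar_power [of i M] *(1)]
      int_pols_mult [OF int_pols_Fvar_power [of i N] *(3)]
    by (intro int_pols_add) (simp_all add: algebra_simps)
  ultimately show ?thesis by (rule laurentI [rotated])
qed

lemma laurent_uminus: "x \<in> laurent i d \<Longrightarrow> - x \<in> laurent i d"
  unfolding laurent_def using int_pols_uminus by (force simp flip: of_pol_simps(3))

lemma laurent_0: "0 \<in> laurent i d"
  using laurent_of_pol [OF int_pols_0] by simp

lemma laurent_sum: "(\<And>x. x \<in> A \<Longrightarrow> g x \<in> laurent i d) \<Longrightarrow> sum g A \<in> laurent i d"
  by (induction A rule: infinite_finite_induct) (auto intro: laurent_add laurent_0)

lemma laurent_f_power_int: "\<bar>m\<bar> \<le> 1 \<Longrightarrow> f_K i powi m \<in> laurent i m"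
proof -
  assume "\<bar>m\<bar> \<le> 1"
  then consider "m = 0" | "m = 1" | "m = -1" by linarith
  then show ?thesis
  proof cases
    case 1
    then show ?thesis using laurent_of_pol [OF int_pols_one] by simp
  next
    case 2
    then show ?thesis using laurent_of_pol [OF int_pols_Fvar_power [of i 1]] by (simp add: f_K_def)
  next
    case 3
    then show ?thesis using laurentI [of 1 1 "-1" i "inverse (f_K i)"] int_pols_one
      by (simp add: power_int_minus)
  qed
qed

section \<open>The effect of a reflection on degrees in f\<close>

lemma s_K_f_laurent: "s_K i (f_K j) - f_K j \<in> laurent i (- 1)"
proof -
  have "\<alpha>_K i / f_K i \<in> laurent i (- 1)"
    by (rule laurentI [of "indet (Alpha i)" 1]) (simp_all add: int_pols_Alpha \<alpha>_K_def)
  then show ?thesis using laurent_uminus [of "\<alpha>_K i / f_K i" i "-1"] by (simp add: laurent_0)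
qed

lemma s_K_gen_laurent:
  assumes "\<And>j. v \<noteq> Tau j"
  shows "s_K i (of_pol (indet v)) \<in> laurent i (int (f_degree (Poly_Mapping.single v 1)))"
proof (cases v)
  case (Alpha j)
  have \<alpha>: "\<alpha>_K k \<in> laurent i 0" for k
    unfolding \<alpha>_K_def by (rule laurent_of_pol [OF int_pols_Alpha])
  show ?thesis
    unfolding Alpha f_degree_single_Alpha s_X by (auto intro!: \<alpha> laurent_add laurent_uminus)
next
  case (Fvar j)
  have "f_K j \<in> laurent i 1"
    using laurent_of_pol [OF int_pols_Fvar_power [of j 1]] by (simp add: f_K_def)
  then have "f_K j + (s_K i (f_K j) - f_K j) \<in> laurent i 1"
    by (rule laurent_add) (rule laurent_mono [OF s_K_f_laurent], simp)
  moreover have "f_K j + (s_K i (f_K j) - f_K j) = s_K i (of_pol (indet (Fvar j)))"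
    by (simp add: f_K_def algebra_simps)
  ultimately show ?thesis unfolding Fvar f_degree_single_Fvar by simp
qed (use assms in auto)

lemma keys_add_single: "keys (m + Poly_Mapping.single v (1::nat)) = insert v (keys m)"
  by (auto simp: in_keys_iff lookup_add lookup_single when_def split: if_splits)

lemma single_add_indet: "Poly_Mapping.single (m + Poly_Mapping.single v 1) 1 = Poly_Mapping.single m 1 * indet v"
  by (simp add: indet_def mult_single)

lemma s_K_mon_laurent:
  "(\<And>j. Tau j \<notin> keys m) \<Longrightarrow> s_K i (of_pol (Poly_Mapping.single m 1)) \<in> laurent i (int (f_degree m))"
proof (induction m rule: mon_induct)
  case zero
  then show ?case using laurent_of_pol [OF int_pols_one] by (simp add: f_degree_0)
next
  case (add m v)
  then have *: "\<And>j. Tau j \<notin> keys m" "\<And>j. v \<noteq> Tau j" unfolding keys_add_single by auto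
  have "s_K i (of_pol (Poly_Mapping.single m 1)) * s_K i (of_pol (indet v))
      \<in> laurent i (int (f_degree m) + int (f_degree (Poly_Mapping.single v 1)))"
    by (intro laurent_mult add.IH s_K_gen_laurent *)
  then show ?case by (simp only: single_add_indet of_pol_simps(2) s_simps f_degree_add of_nat_add)
qed

text \<open>The correction \<alpha>_i / f_i has negative degree, and s(xy) - xy = s(x) (s(y) - y) +
  (s(x) - x) y spreads this to products. Monomials containing some \<alpha> are excluded, as the
  reflection can alter them without lowering the degree.\<close>

lemma s_K_f_mon_laurent:
  "keys m \<subseteq> range Fvar \<Longrightarrow> s_K i (of_pol (Poly_Mapping.single m 1)) - of_pol (Poly_Mapping.single m 1)
     \<in> laurent i (int (f_degree m) - 1)"
proof (induction m rule: mon_induct)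
  case zero
  then show ?case by (simp add: laurent_0)
next
  case (add m v)
  then obtain j where j: "v = Fvar j" and m: "keys m \<subseteq> range Fvar"
    unfolding keys_add_single by auto
  let ?x = "of_pol (Poly_Mapping.single m 1)"
  have "s_K i ?x * (s_K i (f_K j) - f_K j) \<in> laurent i (int (f_degree m) + (- 1))"
    by (intro laurent_mult s_K_mon_laurent s_K_f_laurent) (use m in auto)
  moreover have "(s_K i ?x - ?x) * f_K j \<in> laurent i (int (f_degree m) - 1 + 1)"
    using laurent_of_pol [OF int_pols_Fvar_power [of j 1]]
    by (intro laurent_mult add.IH m) (simp add: f_K_def)
  ultimately have "s_K i ?x * (s_K i (f_K j) - f_K j) + (s_K i ?x - ?x) * f_K j
      \<in> laurent i (int (f_degree m))"
    by (intro laurent_add) (auto intro: laurent_mono)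
  also have "s_K i ?x * (s_K i (f_K j) - f_K j) + (s_K i ?x - ?x) * f_K j
      = s_K i (?x * f_K j) - ?x * f_K j"
    by (simp only: s_simps(2)) (simp only: algebra_simps)
  finally show ?case
    by (simp only: single_add_indet of_pol_simps(2) f_degree_add j f_degree_single_Fvar f_K_def) simp
qed

lemma s_K_int_pols_laurent:
  assumes "p \<in> int_pols d"
  shows "s_K i (of_pol p) \<in> laurent i d"
proof -
  have hom_sum: "s_K i (of_pol (sum g A)) = (\<Sum>a\<in>A. s_K i (of_pol (g a)))" for g and A :: "mon set"
    by (induction A rule: infinite_finite_induct) simp_all
  have "s_K i (of_pol (Poly_Mapping.single m (lookup p m))) \<in> laurent i d" if m: "m \<in> keys p" for m
  proof -
    have "Poly_Mapping.single m (lookup p m) = const_pol (lookup p m) * Poly_Mapping.single m 1"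
      by (simp add: const_pol_def mult_single)
    moreover have "const_pol (lookup p m) \<in> int_pols 0"
      using assms unfolding const_pol_def int_pols_iff [of p]
      by (intro int_pols_single) (simp_all add: f_degree_0)
    ultimately have "s_K i (of_pol (Poly_Mapping.single m (lookup p m))) \<in> laurent i (0 + int (f_degree m))"
      using assms m unfolding int_pols_iff [of p]
      by (simp only: of_pol_simps(2) s_simps(2,3)) (intro laurent_mult laurent_of_pol s_K_mon_laurent, auto)
    then show ?thesis
      by (rule laurent_mono) (use assms m in \<open>simp add: int_pols_iff\<close>)
  qed
  then have "(\<Sum>m\<in>keys p. s_K i (of_pol (Poly_Mapping.single m (lookup p m)))) \<in> laurent i d"
    by (rule laurent_sum)
  then show ?thesis by (simp only: hom_sum [symmetric] pol_sum_single [symmetric])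
qed

text \<open>
  If \<open>h q = f\<^sub>i\<^sup>N r\<close> with \<open>h\<close> free of \<open>f\<close>, then the part of \<open>q\<close> with \<open>f\<^sub>i\<close>-exponents below \<open>N\<close>
  vanishes, since its product with \<open>h\<close> and the rest of the equation have no common monomials.
\<close>

lemma laurent_Int_alpha_denom:
  assumes "x \<in> laurent i d" "x \<in> alpha_denom"
  shows "\<exists>p\<in>int_pols d. x = of_pol p"
proof -
  obtain N q where q: "q \<in> int_pols (int N + d)" "f_K i ^ N * x = of_pol q"
    using assms(1) by (auto simp: laurent_def)
  obtain h r where h: "h \<in> alpha_pols" "h \<noteq> 0" "of_pol h * x = of_pol r"
    using assms(2) by (auto simp: alpha_denom_def)
  define s where "s = Poly_Mapping.single (Fvar i) N"
  define F where "F = Poly_Mapping.single s (1::complex)"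
  have F: "indet (Fvar i) ^ N = F"
    unfolding F_def s_def by (induction N) (auto simp: indet_def mult_single single_add [symmetric])
  have "of_pol (h * q) = of_pol (F * r)"
    unfolding F [symmetric] of_pol_simps of_pol_power q(2) [symmetric] h(3) [symmetric]
    by (simp add: f_K_def)
  then have hq: "h * q = F * r" by (simp only: of_pol_simps(7))
  define A where "A = {m \<in> keys q. N \<le> lookup m (Fvar i)}"
  define p where "p = (\<Sum>m\<in>A. Poly_Mapping.single (m - s) (lookup q m))"
  define b where "b = (\<Sum>m\<in>keys q - A. Poly_Mapping.single m (lookup q m))"
  \<comment> \<open>Subtraction of exponents truncates at 0; on \<open>A\<close> it is
    exact.\<close>
  have split: "m = s + (m - s)" if "m \<in> A" for m
    using that by (intro poly_mapping_eqI)
      (auto simp: A_def s_def lookup_add lookup_minus lookup_single when_def)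
  have "F * p = (\<Sum>m\<in>A. Poly_Mapping.single m (lookup q m))"
    unfolding F_def p_def sum_distrib_left mult_single
    by (rule sum.cong) (simp_all flip: split)
  then have qb: "q = F * p + b"
    using pol_sum_single [of q] sum.subset_diff [of A "keys q" "\<lambda>m. Poly_Mapping.single m (lookup q m)"]
    by (simp add: b_def A_def add.commute)
  have low: "lookup m (Fvar i) < N" if mem: "m \<in> keys (h * b)" for m
  proof -
    obtain a c where a: "a \<in> keys h" and c: "c \<in> keys b" and m: "m = a + c"
      using mem keys_mult [of h b] by auto
    have "Fvar i \<notin> keys a" using a h(1) by (auto simp: alpha_pols_def)
    moreover have "c \<in> keys q - A"
      using c Poly_Mapping.keys_sum [of "\<lambda>m. Poly_Mapping.single m (lookup q m)" "keys q - A"]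
      by (auto simp: b_def split: if_splits)
    ultimately show ?thesis by (auto simp: m A_def lookup_add in_keys_iff)
  qed
  have high: "N \<le> lookup m (Fvar i)" if mem: "m \<in> keys (F * (r - h * p))" for m
  proof -
    obtain c where "m = s + c"
      using mem keys_mult [of F "r - h * p"] by (auto simp: F_def)
    then show ?thesis by (simp add: s_def lookup_add)
  qed
  have "h * b = F * (r - h * p)"
    using hq unfolding qb by (simp add: algebra_simps)
  then have "keys (h * b) = {}" using low high by fastforce
  then have "b = 0" using h(2) by simp
  then have "f_K i ^ N * x = f_K i ^ N * of_pol p"
    using q(2) qb by (simp add: f_K_def flip: F)
  then have "x = of_pol p" by simp
  \<comment> \<open>Integrality and degree are inherited from \<open>q\<close>, whose coefficients
    \<open>p\<close> shares; \<open>r\<close> may have any complex coefficients.\<close>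
  moreover have "p \<in> int_pols d"
    unfolding p_def
  proof (rule int_pols_sum, rule int_pols_single)
    fix m assume m: "m \<in> A"
    show "lookup q m \<in> \<int>" using q(1) by (simp add: int_pols_iff)
    have "m \<in> keys q" using m by (simp add: A_def)
    with q(1) have *: "\<And>j. Tau j \<notin> keys m" "int (f_degree m) \<le> int N + d"
      by (auto simp: int_pols_iff)
    show "Tau j \<notin> keys (m - s)" for j
      using *(1) [of j] by (auto simp: in_keys_iff lookup_minus)
    have "f_degree m = N + f_degree (m - s)"
      using f_degree_add [of s "m - s"] split [OF m] by (simp add: s_def f_degree_single_Fvar)
    with *(2) show "int (f_degree (m - s)) \<le> d" by simp
  qed
  ultimately show ?thesis by blast
qed

section \<open>Young diagrams and Maya diagrams\<close>

lemma initial_segment: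
  fixes S :: "nat set"
  assumes fin: "finite S" and "0 \<notin> S" and down: "\<And>a b. a \<in> S \<Longrightarrow> 1 \<le> b \<Longrightarrow> b \<le> a \<Longrightarrow> b \<in> S"
  shows "S = {1..card S}"
proof (cases "S = {}")
  case False
  have "S = {1..Max S}"
  proof
    show "S \<subseteq> {1..Max S}"
    proof
      fix a assume "a \<in> S"
      moreover from this have "a \<noteq> 0" using assms(2) by metis
      ultimately show "a \<in> {1..Max S}" using fin by simp
    qed
    show "{1..Max S} \<subseteq> S" using down [OF Max_in [OF fin False]] by auto
  qed
  then show ?thesis by (metis card_atLeastAtMost diff_Suc_1)
qed simp

lemma young_pos: "(i, j) \<in> young l \<Longrightarrow> 1 \<le> i \<and> 1 \<le> j"
  by (simp add: young_def)

lemma finite_young: "finite (young l)"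
proof -
  have "young l = Sigma {1..length l} (\<lambda>i. {1..l ! (i - 1)})" by (auto simp: young_def)
  then show ?thesis by simp
qed

lemma finite_young_row: "finite {j. (i, j) \<in> young l}" and finite_young_col: "finite {i. (i, j) \<in> young l}"
proof -
  have "{j. (i, j) \<in> young l} = Pair i -` young l" by auto
  then show "finite {j. (i, j) \<in> young l}" using finite_vimageI [OF finite_young, of "Pair i" l]
    by (simp add: inj_def)
  have "{i. (i, j) \<in> young l} = (\<lambda>i. (i, j)) -` young l" by auto
  then show "finite {i. (i, j) \<in> young l}" using finite_vimageI [OF finite_young, of "\<lambda>i. (i, j)" l]
    by (simp add: inj_def)
qed

lemma young_down:
  assumes "is_partition l" "(i, j) \<in> young l" "1 \<le> i'" "i' \<le> i" "1 \<le> j'" "j' \<le> j"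
  shows "(i', j') \<in> young l"
proof -
  have "l ! (i - 1) \<le> l ! (i' - 1)"
  proof (cases "i' = i")
    case False
    with assms show ?thesis
      unfolding is_partition_def by (intro sorted_wrt_nth_less [of "(\<ge>)" l "i' - 1" "i - 1"]) (auto simp: young_def)
  qed simp
  with assms show ?thesis by (auto simp: young_def)
qed

lemma young_row_eq:
  assumes "is_partition l" shows "(i, j) \<in> young l \<longleftrightarrow> 1 \<le> j \<and> j \<le> part l i"
proof -
  have "{j. (i, j) \<in> young l} = {1..card {j. (i, j) \<in> young l}}"
  proof (rule initial_segment)
    show "b \<in> {j. (i, j) \<in> young l}" if "a \<in> {j. (i, j) \<in> young l}" "1 \<le> b" "b \<le> a" for a b
      using that young_pos [of i a l] young_down [OF assms, of i a i b] by simp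
  qed (use finite_young_row young_pos [of i 0 l] in auto)
  from arg_cong [OF this, of "\<lambda>S. j \<in> S"] show ?thesis
    by (simp only: Defs.part_def mem_Collect_eq atLeastAtMost_iff)
qed

lemma young_col_eq:
  assumes "is_partition l" shows "(i, j) \<in> young l \<longleftrightarrow> 1 \<le> i \<and> i \<le> transposed_part l j"
proof -
  have "{i. (i, j) \<in> young l} = {1..card {i. (i, j) \<in> young l}}"
  proof (rule initial_segment)
    show "b \<in> {i. (i, j) \<in> young l}" if "a \<in> {i. (i, j) \<in> young l}" "1 \<le> b" "b \<le> a" for a b
      using that young_pos [of a j l] young_down [OF assms, of a j b j] by simp
  qed (use finite_young_col young_pos [of 0 j l] in auto)
  from arg_cong [OF this, of "\<lambda>S. i \<in> S"] show ?thesis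
    by (simp only: transposed_part_def mem_Collect_eq atLeastAtMost_iff)
qed

lemma durfee_eq:
  assumes "is_partition l" shows "{1..durfee l} = {n. (n, n) \<in> young l}"
proof -
  let ?D = "{n. (n, n) \<in> young l}"
  have "?D = (\<lambda>n. (n, n)) -` young l" by auto
  then have "finite ?D" using finite_vimageI [OF finite_young, of "\<lambda>n. (n, n)" l] by (simp add: inj_def)
  then have "?D = {1..card ?D}"
  proof (rule initial_segment)
    show "b \<in> ?D" if "a \<in> ?D" "1 \<le> b" "b \<le> a" for a b
      using that young_down [OF assms, of a a b b] by simp
  qed (use young_pos [of 0 0 l] in auto)
  then obtain d where D: "?D = {1..d}" by blast
  have "n = 0 \<or> n \<le> length l \<and> n \<le> part l n \<longleftrightarrow> n \<in> {0..d}" for n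
  proof -
    have "(n, n) \<in> young l \<longleftrightarrow> 1 \<le> n \<and> n \<le> d"
      using arg_cong [OF D, of "\<lambda>S. n \<in> S"] by (simp only: mem_Collect_eq atLeastAtMost_iff)
    moreover have "(n, n) \<in> young l \<Longrightarrow> n \<le> length l" by (simp add: young_def)
    ultimately show ?thesis using young_row_eq [OF assms, of n n] by (cases "n = 0") auto
  qed
  then have "{n. n = 0 \<or> n \<le> length l \<and> n \<le> part l n} = {0..d}" by blast
  then have "durfee l = Max {0..d}" unfolding durfee_def by (rule arg_cong)
  also have "\<dots> = d" by (rule Max_eqI) auto
  finally show ?thesis by (simp only: D)
qed

section \<open>Color counts and Frobenius symbols\<close>

definition maya_count :: "int set \<Rightarrow> int \<Rightarrow> nat" where
  "maya_count M c = (if 0 \<le> c then card (M \<inter> {c<..}) else card ({..c} - M))"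

definition has_frobenius :: "nat list \<Rightarrow> int set \<Rightarrow> bool" where
  "has_frobenius l M \<longleftrightarrow> is_partition l \<and> frobenius_I l = M \<inter> {0<..} \<and> uminus ` frobenius_J l = {..0} - M"

lemma part_antimono:
  assumes "is_partition l" "1 \<le> a" "a \<le> b"
  shows "part l b \<le> part l a"
proof (cases "part l b = 0")
  case False
  then have "(b, part l b) \<in> young l" by (simp add: young_row_eq [OF assms(1)])
  then have "(a, part l b) \<in> young l" by (rule young_down [OF assms(1)]) (use assms False in auto)
  then show ?thesis by (simp add: young_row_eq [OF assms(1)])
qed simp

lemma transposed_part_antimono:
  assumes "is_partition l" "1 \<le> a" "a \<le> b"
  shows "transposed_part l b \<le> transposed_part l a"
proof (cases "transposed_part l b = 0")
  case False
  then have "(transposed_part l b, b) \<in> young l" by (simp add: young_col_eq [OF assms(1)])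
  then have "(transposed_part l b, a) \<in> young l" by (rule young_down [OF assms(1)]) (use assms False in auto)
  then show ?thesis by (simp add: young_col_eq [OF assms(1)])
qed simp

lemma inj_on_antimono_minus:
  fixes g :: "nat \<Rightarrow> nat"
  assumes "\<And>a b. 1 \<le> a \<Longrightarrow> a \<le> b \<Longrightarrow> g b \<le> g a"
  shows "inj_on (\<lambda>n. int (g n) - int n) {1..}"
proof (rule inj_onI)
  have *: "int (g b) - int b < int (g a) - int a" if "1 \<le> a" "a < b" for a b
    using assms [of a b] that by simp
  fix a b :: nat
  assume "a \<in> {1..}" "b \<in> {1..}" "int (g a) - int a = int (g b) - int b"
  then show "a = b" using * [of a b] * [of b a] by (cases a b rule: linorder_cases) auto
qed

lemma inj_on_antimono_minus_add:
  fixes g :: "nat \<Rightarrow> nat"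
  assumes "\<And>a b. 1 \<le> a \<Longrightarrow> a \<le> b \<Longrightarrow> g b \<le> g a"
  shows "inj_on (\<lambda>n. int (g n) - int n + c) {1..}"
  using inj_on_antimono_minus [OF assms] by (simp add: inj_on_def)

lemma image_Collect_Int: "f ` {x \<in> A. f x \<in> C} = f ` A \<inter> C"
  by auto

text \<open>For c >= 0, row n meets the diagonal of color c in its n-th node iff \<lambda>_n >= n +
  c, that is, iff the Frobenius index \<lambda>_n - n + 1 exceeds c. For c < 0 the same is done with
  columns and holes.\<close>

lemma card_color_eq_maya_count:
  assumes "has_frobenius l M"
  shows "card {y \<in> young l. color y = c} = maya_count M c"
proof -
  from assms have l: "is_partition l" and I: "frobenius_I l = M \<inter> {0<..}"
    and J: "uminus ` frobenius_J l = {..0} - M" by (auto simp: has_frobenius_def)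
  show ?thesis
  proof (cases "0 \<le> c")
    case True
    define k where "k = nat c"
    have k: "c = int k" using True by (simp add: k_def)
    define B where "B = {n. (n, n + k) \<in> young l}"
    have "int b - int a = int k \<longleftrightarrow> b = a + k" for a b by linarith
    then have "{y \<in> young l. color y = c} = (\<lambda>n. (n, n + k)) ` B"
      by (auto simp: color_def k B_def)
    then have card_nodes: "card {y \<in> young l. color y = c} = card B"
      by (simp add: card_image inj_on_def)
    have "inj_on (\<lambda>n. int (part l n) - int n + 1) B"
      by (rule inj_on_subset [OF inj_on_antimono_minus_add [OF part_antimono [OF l]]])
        (auto simp: B_def dest: young_pos)
    then have card_B: "card ((\<lambda>n. int (part l n) - int n + 1) ` B) = card B"
      by (rule card_image)
    have image_B: "(\<lambda>n. int (part l n) - int n + 1) ` B = frobenius_I l \<inter> {c<..}"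
    proof -
      have *: "n \<in> B \<longleftrightarrow> n \<in> {1..durfee l} \<and> c < int (part l n) - int n + 1" for n
      proof -
        have "n \<in> B \<longleftrightarrow> 1 \<le> n \<and> n + k \<le> part l n"
          unfolding B_def mem_Collect_eq using young_row_eq [OF l, of n "n + k"] young_pos [of n "n + k" l]
          by linarith
        moreover have "n \<in> {1..durfee l} \<longleftrightarrow> 1 \<le> n \<and> n \<le> part l n"
          unfolding durfee_eq [OF l] by (simp add: young_row_eq [OF l])
        ultimately show ?thesis unfolding k by linarith
      qed
      have "B = {n \<in> {1..durfee l}. int (part l n) - int n + 1 \<in> {c<..}}"
        by (intro Set.set_eqI) (simp only: mem_Collect_eq greaterThan_iff *)
      then show ?thesis unfolding frobenius_I_def by (simp only: image_Collect_Int)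
    qed
    also have "\<dots> = M \<inter> {c<..}" unfolding I using True by auto
    finally show ?thesis using True card_nodes card_B by (simp add: maya_count_def)
  next
    case False
    define k where "k = nat (- c)"
    have k: "c = - int k" using False by (simp add: k_def)
    define B where "B = {n. (n + k, n) \<in> young l}"
    have "int b - int a = - int k \<longleftrightarrow> a = b + k" for a b by linarith
    then have "{y \<in> young l. color y = c} = (\<lambda>n. (n + k, n)) ` B"
      by (auto simp: color_def k B_def)
    then have card_nodes: "card {y \<in> young l. color y = c} = card B"
      by (simp add: card_image inj_on_def)
    have "inj_on (\<lambda>n. int (transposed_part l n) - int n) B"
      by (rule inj_on_subset [OF inj_on_antimono_minus [OF transposed_part_antimono [OF l]]])
        (auto simp: B_def dest: young_pos)
    then have "inj_on (\<lambda>n. - (int (transposed_part l n) - int n)) B"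
      by (simp add: inj_on_def)
    then have card_B: "card ((\<lambda>n. - (int (transposed_part l n) - int n)) ` B) = card B"
      by (rule card_image)
    have image_B: "(\<lambda>n. - (int (transposed_part l n) - int n)) ` B = uminus ` frobenius_J l \<inter> {..c}"
    proof -
      have *: "n \<in> B \<longleftrightarrow> n \<in> {1..durfee l} \<and> - (int (transposed_part l n) - int n) \<le> c" for n
      proof -
        have "n \<in> B \<longleftrightarrow> 1 \<le> n \<and> n + k \<le> transposed_part l n"
          unfolding B_def mem_Collect_eq using young_col_eq [OF l, of "n + k" n] young_pos [of "n + k" n l]
          by linarith
        moreover have "n \<in> {1..durfee l} \<longleftrightarrow> 1 \<le> n \<and> n \<le> transposed_part l n"
          unfolding durfee_eq [OF l] by (simp add: young_col_eq [OF l])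
        ultimately show ?thesis unfolding k by linarith
      qed
      have "B = {n \<in> {1..durfee l}. - (int (transposed_part l n) - int n) \<in> {..c}}"
        by (intro Set.set_eqI) (simp only: mem_Collect_eq atMost_iff *)
      then show ?thesis unfolding frobenius_J_def image_image by (simp only: image_Collect_Int)
    qed
    also have "\<dots> = {..c} - M" unfolding J using False by auto
    finally show ?thesis using False card_nodes card_B by (simp add: maya_count_def)
  qed
qed

text \<open>Each diagonal of a Young diagram is an initial segment, and (i, j) is the node with
  number \<open>min i j\<close> on its diagonal.\<close>

lemma young_eq_color_counts:
  assumes "is_partition l"
  shows "(i, j) \<in> young l \<longleftrightarrow>
    1 \<le> i \<and> 1 \<le> j \<and> min i j \<le> card {y \<in> young l. color y = int j - int i}"
proof (cases "1 \<le> i \<and> 1 \<le> j")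
  case pos: True
  define k where "k = min i j"
  \<comment> \<open>\<open>g\<close> runs along the diagonal through (i, j) from the border: one of
    i - k and j - k is 0, and \<open>g k\<close> is (i, j).\<close>
  define g where "g n = (n + (i - k), n + (j - k))" for n
  define B where "B = {n. 1 \<le> n \<and> g n \<in> young l}"
  have inj: "inj g" by (simp add: g_def inj_def)
  have "{y \<in> young l. color y = int j - int i} = g ` B"
  proof
    show "g ` B \<subseteq> {y \<in> young l. color y = int j - int i}"
      by (auto simp: B_def g_def color_def k_def)
    show "{y \<in> young l. color y = int j - int i} \<subseteq> g ` B"
    proof (intro subsetI)
      fix y assume "y \<in> {y \<in> young l. color y = int j - int i}"
      then obtain a b where y: "y = (a, b)" "(a, b) \<in> young l" "int b - int a = int j - int i"
        by (cases y) (auto simp: color_def)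
      have "g (min a b) = (a, b)" using y(3) by (auto simp: g_def k_def min_def)
      moreover have "1 \<le> min a b" using young_pos [OF y(2)] by simp
      ultimately show "y \<in> g ` B" using y by (intro image_eqI [of _ _ "min a b"]) (auto simp: B_def)
    qed
  qed
  then have card: "card {y \<in> young l. color y = int j - int i} = card B"
    using inj by (simp add: card_image inj_on_subset)
  have "finite B"
    by (rule finite_subset [OF _ finite_vimageI [OF finite_young [of l] inj]]) (auto simp: B_def)
  then have "B = {1..card B}"
  proof (rule initial_segment)
    show "b \<in> B" if "a \<in> B" "1 \<le> b" "b \<le> a" for a b
      using that young_down [OF assms, of "fst (g a)" "snd (g a)" "fst (g b)" "snd (g b)"]
      by (simp add: B_def g_def)
  qed (simp add: B_def)
  then have "k \<in> B \<longleftrightarrow> k \<in> {1..card B}" by (rule arg_cong)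
  moreover have "k \<in> B \<longleftrightarrow> (i, j) \<in> young l" "1 \<le> k" using pos by (auto simp: B_def g_def k_def)
  ultimately show ?thesis using pos by (simp add: card k_def)
qed (auto dest: young_pos)

lemma young_inj:
  assumes l: "is_partition l" and l': "is_partition l'" and eq: "young l = young l'"
  shows "l = l'"
proof (rule nth_equalityI)
  have len: "length l = transposed_part l 1" if "is_partition l" for l
  proof -
    have "l ! i \<noteq> 0" if "i < length l" for i
      using \<open>is_partition l\<close> nth_mem [OF that] unfolding is_partition_def by metis
    then have "{i. (i, 1) \<in> young l} = {1..length l}" by (auto simp: young_def Suc_le_eq)
    then show ?thesis by (simp add: transposed_part_def)
  qed
  have "transposed_part l 1 = transposed_part l' 1" by (simp add: transposed_part_def eq)
  then show len': "length l = length l'" using len l l' by metis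
  fix i assume i: "i < length l"
  have "part l (Suc i) = part l' (Suc i)" by (simp add: Defs.part_def eq)
  then show "l ! i = l' ! i" using i len' by (simp add: part_nth)
qed

text \<open>The Frobenius symbol fixes all color counts, and these fix the diagram.\<close>

lemma has_frobenius_unique:
  assumes "has_frobenius l M" "has_frobenius l' M"
  shows "l = l'"
proof (rule young_inj)
  show l: "is_partition l" "is_partition l'" using assms by (auto simp: has_frobenius_def)
  have "(i, j) \<in> young l \<longleftrightarrow> (i, j) \<in> young l'" for i j
    unfolding young_eq_color_counts [OF l(1), of i j] young_eq_color_counts [OF l(2), of i j]
      card_color_eq_maya_count [OF assms(1)] card_color_eq_maya_count [OF assms(2)] by simp
  then show "young l = young l'" by auto
qed

text \<open>
  For \<open>c = 0\<close> there are as many elements of \<open>M\<close> above \<open>0\<close> as holes up to \<open>0\<close>; the summand \<open>c\<close>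
  makes the condition independent of \<open>c\<close>.
\<close>

definition charge_zero :: "int set \<Rightarrow> int \<Rightarrow> bool" where
  "charge_zero M c \<longleftrightarrow> finite (M \<inter> {c<..}) \<and> finite ({..c} - M)
     \<and> int (card ({..c} - M)) = int (card (M \<inter> {c<..})) + c"

lemma greaterThan_insert: "{c<..} = insert (c + 1) {c + 1<..}" for c :: int
  by auto

lemma atMost_insert: "{..c + 1} = insert (c + 1) {..c}" for c :: int
  by auto

text \<open>If c+1 lies in \<open>M\<close>, one element above the cut is lost, otherwise one hole
  below it is gained; the summand c compensates for either.\<close>

lemma charge_zero_step: "charge_zero M (c + 1) \<longleftrightarrow> charge_zero M c"
proof (cases "c + 1 \<in> M")
  case True
  then have above: "M \<inter> {c<..} = insert (c + 1) (M \<inter> {c + 1<..})"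
    unfolding greaterThan_insert [of c] by blast
  have below: "{..c + 1} - M = {..c} - M"
    using True unfolding atMost_insert by blast
  show ?thesis
    unfolding charge_zero_def above below
    by (cases "finite (M \<inter> {c + 1<..})") auto
next
  case False
  then have above: "M \<inter> {c<..} = M \<inter> {c + 1<..}"
    unfolding greaterThan_insert [of c] by blast
  have below: "{..c + 1} - M = insert (c + 1) ({..c} - M)"
    using False unfolding atMost_insert by blast
  show ?thesis
    unfolding charge_zero_def above below
    by (cases "finite ({..c} - M)") auto
qed

lemma charge_zero_all:
  assumes "charge_zero M c"
  shows "charge_zero M d"
proof (induction d rule: int_induct [of _ c])
  case base
  show ?case by (rule assms)
next
  case (step1 i)
  then show ?case by (simp add: charge_zero_step)
next
  case (step2 i)
  then show ?case using charge_zero_step [of M "i - 1"] by simp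
qed

text \<open>Exchanging i and i+1 crosses only the cut between them.\<close>

lemma maya_gen_above: "c \<noteq> i \<Longrightarrow> maya (weyl_gen i * w) \<inter> {c<..} = adj_swap i ` (maya w \<inter> {c<..})"
  and maya_gen_below: "c \<noteq> i \<Longrightarrow> {..c} - maya (weyl_gen i * w) = adj_swap i ` ({..c} - maya w)"
proof -
  have *: "x \<in> adj_swap i ` A \<longleftrightarrow> adj_swap i x \<in> A" for x A by (metis adj_swap_invol image_iff)
  assume "c \<noteq> i"
  then have "c < adj_swap i x \<longleftrightarrow> c < x" for x by (auto simp: adj_swap_def)
  then show "maya (weyl_gen i * w) \<inter> {c<..} = adj_swap i ` (maya w \<inter> {c<..})"
    "{..c} - maya (weyl_gen i * w) = adj_swap i ` ({..c} - maya w)"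
    unfolding set_eq_iff * by (auto simp: mem_maya_gen not_less [symmetric])
qed

lemma card_adj_swap: "card (adj_swap i ` A) = card A"
  by (rule card_image) (rule inj_on_subset [OF inj_adj_swap], simp)

lemma charge_zero_maya: "charge_zero (maya w) c"
proof (induction w arbitrary: c rule: weyl_induct)
  case one
  have "{..0} \<inter> {0<..} = ({} :: int set)" by auto
  then have "charge_zero (maya 1) 0" by (simp add: charge_zero_def maya_one)
  then show ?case by (rule charge_zero_all)
next
  case (gen i w)
  have "charge_zero (maya (weyl_gen i * w)) (i + 1)"
    using gen [of "i + 1"] by (simp add: charge_zero_def maya_gen_above maya_gen_below card_adj_swap)
  then show ?case by (rule charge_zero_all)
qed

text \<open>At c = i an element i moves above the cut and an element i+1 moves below it. Elements
  above the cut and holes below it change by the same amount.\<close>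

lemma maya_count_gen:
  "int (maya_count (maya (weyl_gen i * w)) c)
     = int (maya_count (maya w) c) + (if c = i then maya_jump w i else 0)"
proof (cases "c = i")
  case False
  then show ?thesis by (simp add: maya_count_def maya_gen_above maya_gen_below card_adj_swap)
next
  case True
  let ?M = "maya w" and ?M' = "maya (weyl_gen i * w)"
  \<comment> \<open>Splitting off the position next to the cut leaves the cuts at i+1 and i-1, which
    are not crossed; \<open>charge_zero\<close> provides finiteness.\<close>
  have above: "int (card (M \<inter> {i<..})) = of_bool (i + 1 \<in> M) + int (card (M \<inter> {i + 1<..}))"
    if "charge_zero M (i + 1)" for M
  proof -
    have "M \<inter> {i<..} = (if i + 1 \<in> M then insert (i + 1) (M \<inter> {i + 1<..}) else M \<inter> {i + 1<..})"
      unfolding greaterThan_insert [of i] by (cases "i + 1 \<in> M") simp_all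
    then show ?thesis using that by (cases "i + 1 \<in> M") (simp_all add: charge_zero_def)
  qed
  have below: "int (card ({..i} - M)) = of_bool (i \<notin> M) + int (card ({..i - 1} - M))"
    if "charge_zero M (i - 1)" for M
  proof -
    have "{..i} = insert i {..i - 1}" using atMost_insert [of "i - 1"] by simp
    then have "{..i} - M = (if i \<in> M then {..i - 1} - M else insert i ({..i - 1} - M))"
      by (simp add: insert_Diff_if)
    then show ?thesis using that by (cases "i \<in> M") (simp_all add: charge_zero_def)
  qed
  have "i + 1 \<in> ?M' \<longleftrightarrow> i \<in> ?M" "i \<in> ?M' \<longleftrightarrow> i + 1 \<in> ?M" by (simp_all add: mem_maya_gen adj_swap_def)
  moreover have "card (?M' \<inter> {i + 1<..}) = card (?M \<inter> {i + 1<..})" "card ({..i - 1} - ?M') = card ({..i - 1} - ?M)"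
    by (simp_all add: maya_gen_above maya_gen_below card_adj_swap)
  ultimately show ?thesis using True above [OF charge_zero_maya] below [OF charge_zero_maya]
    by (simp add: maya_count_def maya_jump_def)
qed

section \<open>The partition of a Maya diagram of charge zero\<close>

lemma card_above_nth:
  fixes xs :: "int list"
  assumes "sorted_wrt (>) xs" "k < length xs"
  shows "card (set xs \<inter> {xs ! k<..}) = k"
proof -
  have lt: "xs ! b < xs ! a" if "a < b" "b < length xs" for a b
    using sorted_wrt_nth_less [OF assms(1)] that by blast
  have eq: "set xs \<inter> {xs ! k<..} = (!) xs ` {..<k}"
  proof
    show "set xs \<inter> {xs ! k<..} \<subseteq> (!) xs ` {..<k}"
    proof
      fix x assume "x \<in> set xs \<inter> {xs ! k<..}"
      then obtain a where a: "a < length xs" "x = xs ! a" "xs ! k < xs ! a" by (auto simp: in_set_conv_nth)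
      have "a < k" using lt [of k a] a by (cases a k rule: linorder_cases) auto
      with a show "x \<in> (!) xs ` {..<k}" by blast
    qed
    show "(!) xs ` {..<k} \<subseteq> set xs \<inter> {xs ! k<..}" using lt assms(2) by auto
  qed
  have "inj_on ((!) xs) {..<k}"
  proof (rule inj_onI)
    fix a b assume "a \<in> {..<k}" "b \<in> {..<k}" "xs ! a = xs ! b"
    then show "a = b" using lt [of a b] lt [of b a] assms(2) by (cases a b rule: linorder_cases) auto
  qed
  then show ?thesis by (simp add: eq card_image)
qed

text \<open>
  The rows of the Young diagram belong to the elements \<open>m\<close> of the Maya diagram in decreasing order;
  the length of a row is the number of holes below \<open>m\<close>.
\<close>

lemma ex_has_frobenius:
  assumes ch: "\<And>c. charge_zero M c"
  shows "\<exists>l. has_frobenius l M"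
proof -
  define h where "h m = card ({..m} - M)" for m
  have fin_holes: "finite ({..c} - M)" and fin_above: "finite (M \<inter> {c<..})"
    and charge: "int (h c) = int (card (M \<inter> {c<..})) + c" for c
    using ch [of c] by (auto simp: charge_zero_def h_def)
  have h_mono: "h a \<le> h b" if "a \<le> b" for a b
    unfolding h_def by (rule card_mono [OF fin_holes]) (use that in auto)
  \<comment> \<open>Elements with no hole below them would give rows of length 0, which a partition
    does not list.\<close>
  define S where "S = {m \<in> M. h m \<noteq> 0}"
  have "finite S"
  proof -
    have holes: "h m = 0 \<longleftrightarrow> {..m} - M = {}" for m by (simp add: h_def fin_holes)
    obtain c where c: "\<And>x. x \<in> {..0} - M \<Longrightarrow> c \<le> x" "c \<le> 0"
    proof (cases "{..0} - M = {}")
      case False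
      show ?thesis
        by (rule that [of "min 0 (Min ({..0} - M))"]) (use fin_holes [of 0] in \<open>auto simp: min_le_iff_disj\<close>)
    qed (use that [of 0] in auto)
    have "S \<subseteq> M \<inter> {c - 1<..}"
    proof
      fix m assume m: "m \<in> S"
      then obtain x where "x \<le> m" "x \<notin> M" by (auto simp: S_def holes)
      then have "c \<le> m" using c(1) [of x] c(2) by force
      with m show "m \<in> M \<inter> {c - 1<..}" by (auto simp: S_def)
    qed
    then show ?thesis using fin_above finite_subset by blast
  qed
  define xs where "xs = rev (sorted_list_of_set S)"
  have sorted: "sorted_wrt (>) xs"
    by (simp add: xs_def sorted_wrt_rev)
  have set_xs: "set xs = S" using \<open>finite S\<close> by (simp add: xs_def)
  have xs_M: "xs ! k \<in> M" "h (xs ! k) \<noteq> 0" if "k < length xs" for k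
    using nth_mem [OF that] by (auto simp: set_xs S_def)
  \<comment> \<open>Since \<open>h\<close> is monotone, all elements of \<open>M\<close> above
    \<open>xs ! k\<close> are listed, so there are k of them. The charge condition then makes
    \<open>xs ! k\<close> the Frobenius index of row k+1.\<close>
  have h_xs: "int (h (xs ! k)) = int k + xs ! k" if "k < length xs" for k
  proof -
    have "h m \<noteq> 0" if "xs ! k < m" for m
      using h_mono [of "xs ! k" m] xs_M(2) [OF \<open>k < length xs\<close>] that by simp
    then have "M \<inter> {xs ! k<..} = set xs \<inter> {xs ! k<..}"
      unfolding set_xs S_def by auto
    then show ?thesis using charge [of "xs ! k"] card_above_nth [OF sorted that] by simp
  qed
  define l where "l = map h xs"
  have part: "is_partition l"
    unfolding is_partition_def l_def
  proof
    show "sorted_wrt (\<ge>) (map h xs)"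
      unfolding sorted_wrt_map by (rule sorted_wrt_mono_rel [OF _ sorted]) (simp add: h_mono)
    show "0 \<notin> set (map h xs)" by (auto simp: set_xs S_def)
  qed
  have young: "(n, j) \<in> young l \<longleftrightarrow> 1 \<le> n \<and> n \<le> length xs \<and> 1 \<le> j \<and> j \<le> h (xs ! (n - 1))" for n j
    by (auto simp: young_def l_def)
  have part_l: "int (part l n) - int n + 1 = xs ! (n - 1)" if "1 \<le> n" "n \<le> length xs" for n
    using that h_xs [of "n - 1"] part_nth [of n l] by (simp add: l_def)
  have diag: "n \<in> {1..durfee l} \<longleftrightarrow> 1 \<le> n \<and> n \<le> length xs \<and> 0 < xs ! (n - 1)" for n
  proof -
    have "n \<in> {1..durfee l} \<longleftrightarrow> 1 \<le> n \<and> n \<le> length xs \<and> n \<le> h (xs ! (n - 1))"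
      unfolding durfee_eq [OF part] by (auto simp: young)
    moreover have "n \<le> h (xs ! (n - 1)) \<longleftrightarrow> 0 < xs ! (n - 1)" if "1 \<le> n" "n \<le> length xs"
    proof -
      have "int (h (xs ! (n - 1))) = int n - 1 + xs ! (n - 1)"
        using h_xs [of "n - 1"] that by (simp add: of_nat_diff)
      then show ?thesis by linarith
    qed
    ultimately show ?thesis by blast
  qed
  have I: "frobenius_I l = M \<inter> {0<..}"
  proof
    show "frobenius_I l \<subseteq> M \<inter> {0<..}"
    proof
      fix x assume "x \<in> frobenius_I l"
      then obtain n where n: "n \<in> {1..durfee l}" "x = int (part l n) - int n + 1"
        unfolding frobenius_I_def by blast
      then show "x \<in> M \<inter> {0<..}" using xs_M(1) [of "n - 1"] part_l [of n] unfolding diag by auto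
    qed
    show "M \<inter> {0<..} \<subseteq> frobenius_I l"
    proof
      fix x assume x: "x \<in> M \<inter> {0<..}"
      then have "h x \<noteq> 0" using charge [of x] by auto
      with x have "x \<in> set xs" by (simp add: set_xs S_def)
      then obtain k where k: "k < length xs" "x = xs ! k" by (auto simp: in_set_conv_nth)
      then have "Suc k \<in> {1..durfee l}" unfolding diag using x by auto
      then have "int (part l (Suc k)) - int (Suc k) + 1 \<in> frobenius_I l"
        unfolding frobenius_I_def by (rule imageI)
      then show "x \<in> frobenius_I l" using part_l [of "Suc k"] k by simp
    qed
  qed
  have transposed: "transposed_part l j = card {m \<in> M. j \<le> h m}" if "1 \<le> j" for j
  proof -
    have "distinct xs" by (simp add: xs_def)
    then have inj: "inj_on (\<lambda>n. xs ! (n - 1)) {1..length xs}"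
      by (auto simp: inj_on_def nth_eq_iff_index_eq)
    have "(\<lambda>n. xs ! (n - 1)) ` {1..length xs} = set xs"
    proof
      show "set xs \<subseteq> (\<lambda>n. xs ! (n - 1)) ` {1..length xs}"
      proof
        fix x assume "x \<in> set xs"
        then obtain k where "k < length xs" "x = xs ! k" by (auto simp: in_set_conv_nth)
        then show "x \<in> (\<lambda>n. xs ! (n - 1)) ` {1..length xs}" by (intro image_eqI [of _ _ "Suc k"]) auto
      qed
    qed (auto intro!: nth_mem)
    then have "{m \<in> M. j \<le> h m} = (\<lambda>n. xs ! (n - 1)) ` {n \<in> {1..length xs}. xs ! (n - 1) \<in> {m. j \<le> h m}}"
      unfolding image_Collect_Int using that by (auto simp: set_xs S_def)
    also have "card \<dots> = card {n \<in> {1..length xs}. xs ! (n - 1) \<in> {m. j \<le> h m}}"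
      by (rule card_image) (rule inj_on_subset [OF inj], auto)
    also have "{n \<in> {1..length xs}. xs ! (n - 1) \<in> {m. j \<le> h m}} = {n. (n, j) \<in> young l}"
      using that by (auto simp: young)
    finally show ?thesis by (simp add: transposed_part_def)
  qed
  \<comment> \<open>Column \<open>h x\<close> belongs to the hole x: the rows reaching it are those
    of the elements above x, and the charge condition at x counts these as
    \<open>h x - x\<close>.\<close>
  have transposed_hole: "int (transposed_part l (h x)) - int (h x) = - x" and h_hole: "1 \<le> h x"
    if "x \<notin> M" for x
  proof -
    have x: "x \<in> {..x} - M" using that by simp
    then have "h x \<noteq> 0" unfolding h_def using fin_holes by (metis card_0_eq empty_iff)
    then show "1 \<le> h x" by simp
    have "h x \<le> h m \<longleftrightarrow> x < m" if "m \<in> M" for m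
    proof (cases "x \<le> m")
      case True
      then show ?thesis using h_mono [of x m] that \<open>x \<notin> M\<close> by (cases "x = m") auto
    next
      case False
      then have "{..m} - M \<subset> {..x} - M" using x by auto
      then have "h m < h x" unfolding h_def by (rule psubset_card_mono [OF fin_holes])
      with False show ?thesis by simp
    qed
    then have "{m \<in> M. h x \<le> h m} = M \<inter> {x<..}" by auto
    then show "int (transposed_part l (h x)) - int (h x) = - x"
      using transposed [OF \<open>1 \<le> h x\<close>] charge [of x] by simp
  qed
  have inj_h: "inj_on h ({..0} - M)"
  proof (rule inj_onI)
    fix x y assume "x \<in> {..0} - M" "y \<in> {..0} - M" and eq: "h x = h y"
    then have "x \<notin> M" "y \<notin> M" by auto
    from transposed_hole [OF this(1), unfolded eq] transposed_hole [OF this(2)] show "x = y" by linarith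
  qed
  \<comment> \<open>One inclusion and equal sizes suffice. Both sizes are \<open>h 0\<close>: by the
    charge condition there are as many holes up to 0 as positive elements, and the latter form
    \<open>frobenius_I l\<close>.\<close>
  have "h ` ({..0} - M) = {1..durfee l}"
  proof (rule card_subset_eq)
    show "h ` ({..0} - M) \<subseteq> {1..durfee l}"
    proof (rule image_subsetI)
      fix x assume "x \<in> {..0} - M"
      then have x: "x \<le> 0" "x \<notin> M" by simp_all
      have "h x \<le> transposed_part l (h x)" using transposed_hole [OF x(2)] x(1) by linarith
      then have "(h x, h x) \<in> young l"
        unfolding young_col_eq [OF part] using h_hole [OF x(2)] by blast
      then show "h x \<in> {1..durfee l}" unfolding durfee_eq [OF part] by (rule CollectI)
    qed
    have "inj_on (\<lambda>n. int (part l n) - int n + 1) {1..durfee l}"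
      by (rule inj_on_subset [OF inj_on_antimono_minus_add [OF part_antimono [OF part]]]) auto
    then have "card (frobenius_I l) = card {1..durfee l}"
      unfolding frobenius_I_def by (rule card_image)
    moreover have "card (frobenius_I l) = h 0" unfolding I using charge [of 0] by linarith
    moreover have "card (h ` ({..0} - M)) = h 0"
      unfolding card_image [OF inj_h] by (simp only: h_def)
    ultimately show "card (h ` ({..0} - M)) = card {1..durfee l}" by (simp only:)
  qed simp
  from this [symmetric]
  have "uminus ` frobenius_J l = (\<lambda>x. - (int (transposed_part l (h x)) - int (h x))) ` ({..0} - M)"
    unfolding frobenius_J_def by (simp only: image_image)
  also have "\<dots> = (\<lambda>x. x) ` ({..0} - M)"
    by (rule image_cong) (simp_all add: transposed_hole)
  finally have "uminus ` frobenius_J l = {..0} - M" by simp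
  with part I show ?thesis unfolding has_frobenius_def by blast
qed

lemma num_nodes_eq: "num_nodes w i = maya_count (maya w) i"
proof -
  obtain l where l: "has_frobenius l (maya w)"
    using ex_has_frobenius charge_zero_maya by blast
  then have "partition_of w = l"
    unfolding partition_of_def
    by (intro the_equality) (auto simp: has_frobenius_def intro: has_frobenius_unique [unfolded has_frobenius_def])
  then show ?thesis using card_color_eq_maya_count [OF l] by (simp add: num_nodes_def)
qed

lemma num_nodes_one: "num_nodes 1 i = 0"
  unfolding num_nodes_eq maya_count_def maya_one by (auto simp: card_eq_0_iff)

lemma num_nodes_gen:
  "int (num_nodes (weyl_gen i * w) c) = int (num_nodes w c) + (if c = i then maya_jump w i else 0)"
  by (simp only: num_nodes_eq maya_count_gen)

section \<open>Polynomiality and the leading term\<close>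

lemma maya_jump_bound: "\<bar>maya_jump w i\<bar> \<le> 1"
  by (simp add: maya_jump_def)

text \<open>A remainder of strictly smaller degree is the form that survives a reflection. For the
  identity the bound is -1, which forces the remainder 0.\<close>

lemma phi_leading_form:
  "\<exists>\<mu>. keys \<mu> \<subseteq> range Fvar \<and> (\<forall>c. lookup \<mu> (Fvar c) = num_nodes w c) \<and>
     (\<exists>z\<in>int_pols (int (f_degree \<mu>) - 1). phi_Lambda0 w = of_pol (Poly_Mapping.single \<mu> 1 + z))"
proof (induction w rule: weyl_induct)
  case one
  show ?case
    by (intro exI [of _ 0] conjI bexI [of _ 0])
      (simp_all add: num_nodes_one phi_one int_pols_0)
next
  case (gen i w)
  then obtain \<mu> z where \<mu>: "keys \<mu> \<subseteq> range Fvar" "\<And>c. lookup \<mu> (Fvar c) = num_nodes w c"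
    and z: "z \<in> int_pols (int (f_degree \<mu>) - 1)" and phi: "phi_Lambda0 w = of_pol (Poly_Mapping.single \<mu> 1 + z)"
    by blast
  let ?s = "Poly_Mapping.single (Fvar i) (1::nat)"
  define e where "e = maya_jump w i"
  have e_cases: "e = 0 \<or> e = 1 \<or> e = -1"
    using maya_jump_bound [of w i] unfolding e_def by linarith
  have count: "int (num_nodes (weyl_gen i * w) c) = int (num_nodes w c) + (if c = i then e else 0)" for c
    by (simp add: num_nodes_gen e_def)
  have "\<exists>\<mu>'. keys \<mu>' \<subseteq> range Fvar \<and> (\<forall>c. lookup \<mu>' (Fvar c) = num_nodes (weyl_gen i * w) c)
      \<and> int (f_degree \<mu>') = int (f_degree \<mu>) + e
      \<and> of_pol (Poly_Mapping.single \<mu>' 1) = f_K i powi e * of_pol (Poly_Mapping.single \<mu> 1)"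
    using e_cases
  proof (elim disjE)
    assume e: "e = 0"
    have "num_nodes (weyl_gen i * w) c = num_nodes w c" for c
      using count [of c] by (simp only: e if_cancel add_0_right of_nat_eq_iff)
    then show ?thesis using e \<mu> by (intro exI [of _ \<mu>]) simp
  next
    assume e: "e = 1"
    have "lookup (\<mu> + ?s) (Fvar c) = num_nodes (weyl_gen i * w) c" for c
      using count [of c] by (simp add: e \<mu>(2) lookup_add lookup_single when_def split: if_splits)
    then show ?thesis
      using \<mu>(1) unfolding e
      by (intro exI [of _ "\<mu> + ?s"])
        (simp add: keys_add_single [simplified] f_degree_add f_degree_single_Fvar
           single_add_indet [simplified] f_K_def mult.commute)
  next
    assume e: "e = -1"
    \<comment> \<open>The node count of \<open>weyl_gen i * w\<close> is a natural number and one
      less than that of \<open>w\<close>, so f_i divides the monomial.\<close>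
    then have "lookup \<mu> (Fvar i) \<noteq> 0" using count [of i] by (simp add: \<mu>(2))
    then have split: "\<mu> = (\<mu> - ?s) + ?s"
      by (intro poly_mapping_eqI) (auto simp: lookup_add lookup_minus lookup_single when_def)
    have "lookup (\<mu> - ?s) (Fvar c) = num_nodes (weyl_gen i * w) c" for c
      using count [of c] by (simp add: e \<mu>(2) lookup_minus lookup_single when_def split: if_splits)
    moreover have "keys (\<mu> - ?s) \<subseteq> range Fvar"
      using \<mu>(1) by (auto simp: in_keys_iff lookup_minus subset_eq)
    moreover have "f_degree \<mu> = f_degree (\<mu> - ?s) + 1"
      using f_degree_add [of "\<mu> - ?s" ?s] by (simp only: split [symmetric] f_degree_single_Fvar)
    moreover have "of_pol (Poly_Mapping.single \<mu> 1) = of_pol (Poly_Mapping.single (\<mu> - ?s) 1) * f_K i"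
      using single_add_indet [of "\<mu> - ?s" "Fvar i"] by (simp only: split [symmetric] of_pol_simps(2) f_K_def)
    ultimately show ?thesis
      unfolding e by (intro exI [of _ "\<mu> - ?s"]) (simp add: power_int_minus)
  qed
  then obtain \<mu>' where \<mu>': "keys \<mu>' \<subseteq> range Fvar" "\<And>c. lookup \<mu>' (Fvar c) = num_nodes (weyl_gen i * w) c"
    and deg: "int (f_degree \<mu>') = int (f_degree \<mu>) + e"
    and mon: "of_pol (Poly_Mapping.single \<mu>' 1) = f_K i powi e * of_pol (Poly_Mapping.single \<mu> 1)"
    by blast
  let ?m = "of_pol (Poly_Mapping.single \<mu> 1)" and ?m' = "of_pol (Poly_Mapping.single \<mu>' 1)"
  \<comment> \<open>The new remainder: the recursion bounds its degree in the Laurent ring, and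
    \<open>phi_denom\<close> excludes the pole along f_i = 0.\<close>
  define x where "x = phi_Lambda0 (weyl_gen i * w) - ?m'"
  have "x = f_K i powi e * ((s_K i ?m - ?m) + s_K i (of_pol z))"
    unfolding x_def phi_gen phi mon e_def [symmetric] of_pol_simps(1) s_simps(1) by (simp only: algebra_simps)
  also have "\<dots> \<in> laurent i (e + (int (f_degree \<mu>) - 1))"
    using maya_jump_bound [of w i] unfolding e_def [symmetric]
    by (intro laurent_mult laurent_add laurent_f_power_int s_K_f_mon_laurent \<mu>(1) s_K_int_pols_laurent z)
  finally have "x \<in> laurent i (int (f_degree \<mu>') - 1)" by (simp add: deg algebra_simps)
  moreover have "x \<in> alpha_denom"
    unfolding x_def diff_conv_add_uminus
    by (intro alpha_denom_add alpha_denom_uminus phi_denom alpha_denom_of_pol)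
  ultimately obtain z' where z': "z' \<in> int_pols (int (f_degree \<mu>') - 1)" "x = of_pol z'"
    using laurent_Int_alpha_denom by blast
  have "phi_Lambda0 (weyl_gen i * w) = of_pol (Poly_Mapping.single \<mu>' 1 + z')"
    using z'(2) by (simp add: x_def algebra_simps)
  with \<mu>' z'(1) show ?case by blast
qed

lemma f_leading_term_dominant_mon:
  assumes z: "\<And>m. m \<in> keys z \<Longrightarrow> f_degree m < f_degree \<mu>"
  shows "f_leading_term (Poly_Mapping.single \<mu> 1 + z) = Poly_Mapping.single \<mu> 1"
proof -
  let ?p = "Poly_Mapping.single \<mu> 1 + z"
  have "\<mu> \<notin> keys z" using z by blast
  then have coeff: "lookup ?p \<mu> = 1" by (simp add: lookup_add in_keys_iff)
  then have \<mu>: "\<mu> \<in> keys ?p" by (simp add: in_keys_iff)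
  have other: "f_degree m < f_degree \<mu>" if "m \<in> keys ?p" "m \<noteq> \<mu>" for m
    using that z [of m] by (auto simp: in_keys_iff lookup_add lookup_single when_def)
  have "Max (f_degree ` keys ?p) = f_degree \<mu>"
    by (rule Max_eqI) (use \<mu> other in \<open>force+\<close>)
  then have "{m. m \<in> keys ?p \<and> f_degree m = Max (f_degree ` keys ?p)} = {\<mu>}"
    using \<mu> other by force
  then show ?thesis unfolding f_leading_term_def by (simp add: coeff)
qed

lemma single_eq_Prod_any_Fvar:
  assumes "keys \<mu> \<subseteq> range Fvar"
  shows "Poly_Mapping.single \<mu> 1 = Prod_any (\<lambda>i. indet (Fvar i) ^ lookup \<mu> (Fvar i))"
  using assms
proof (induction \<mu> rule: mon_induct)
  case zero
  then show ?case by simp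
next
  case (add m v)
  then obtain j where v: "v = Fvar j" and m: "keys m \<subseteq> range Fvar"
    unfolding keys_add_single by auto
  have fin: "finite {i. indet (Fvar i) ^ lookup m (Fvar i) \<noteq> 1}"
    by (rule finite_subset [OF _ finite_Fvar_support [of m]]) (auto intro!: Nat.gr0I)
  have fin': "finite {i. (if i = j then indet (Fvar i) else 1) \<noteq> 1}"
    by (rule finite_subset [of _ "{j}"]) auto
  have "Prod_any (\<lambda>i. indet (Fvar i) ^ lookup (m + Poly_Mapping.single v 1) (Fvar i))
      = Prod_any (\<lambda>i. indet (Fvar i) ^ lookup m (Fvar i) * (if i = j then indet (Fvar i) else 1))"
    by (rule Prod_any.cong) (simp add: v lookup_add lookup_single when_def power_add)
  also have "\<dots> = Prod_any (\<lambda>i. indet (Fvar i) ^ lookup m (Fvar i))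
      * Prod_any (\<lambda>i. if i = j then indet (Fvar i) else 1)"
    by (rule Prod_any.distrib [OF fin fin'])
  also have "\<dots> = Poly_Mapping.single m 1 * indet v"
    by (simp add: add.IH [OF m] Prod_any.delta v)
  finally show ?case by (simp only: single_add_indet)
qed

theorem mainTheorem3:
  fixes w :: weyl
  shows "\<exists>p\<in>int_pol_alpha_f. phi_Lambda0 w = of_pol p
      \<and> f_leading_term p = Prod_any (\<lambda>i. indet (Fvar i) ^ num_nodes w i)"
proof -
  obtain \<mu> z where \<mu>: "keys \<mu> \<subseteq> range Fvar" "\<And>c. lookup \<mu> (Fvar c) = num_nodes w c"
    and z: "z \<in> int_pols (int (f_degree \<mu>) - 1)" and phi: "phi_Lambda0 w = of_pol (Poly_Mapping.single \<mu> 1 + z)"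
    using phi_leading_form by blast
  let ?p = "Poly_Mapping.single \<mu> 1 + z"
  have "?p \<in> int_pols (int (f_degree \<mu>))"
    using \<mu>(1) int_pols_mono [OF z] by (intro int_pols_add int_pols_single) auto
  then have "?p \<in> int_pol_alpha_f" by (simp add: int_pols_def)
  moreover have "f_leading_term ?p = Poly_Mapping.single \<mu> 1"
    by (rule f_leading_term_dominant_mon) (use z in \<open>auto simp: int_pols_iff\<close>)
  moreover have "Poly_Mapping.single \<mu> 1 = Prod_any (\<lambda>i. indet (Fvar i) ^ num_nodes w i)"
    using single_eq_Prod_any_Fvar [OF \<mu>(1)] by (simp only: \<mu>(2))
  ultimately show ?thesis using phi by (intro bexI [of _ ?p] conjI) simp_all
qed

end
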